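(* Let $G$ be the free group on $\alpha,\beta$, and consider each of the 14 self-similar actions of $G$ on the rooted binary tree $\{1,2\}^*$ given by the wreath recursions listed in the context, with the associated (possibly infinite) nucleus $\mathcal N$ listed there. In each case the image of $\mathcal N$ in the faithful quotient of the self-similar action is finite. That is, the bisets of these self-similar actions are all sub-hyperbolic (the self-similar action of the faithful quotient is contracting).
   Context: Wreath recursion: $h=\langle h|_1,h|_2\rangle\pi_h$ means that $h$ permutes the first level $\{1,2\}$ by $\pi_h$ and has restrictions $h|_1,h|_2\in G$ at the vertices $1,2$; $\sigma$ denotes the nontrivial permutation and a trivial permutation is omitted. Products: $\langle g|_1,g|_2\rangle\pi\cdot\langle h|_1,h|_2\rangle\tau=\langle g|_1h|_{\pi(1)},g|_2h|_{\pi(2)}\rangle\pi\tau$. Restrictions $h|_v$ to words $v$ are defined by iterating. The faithful quotient is the quotient of $G$ by the kernel of the action on the tree. A self-similar action is contracting if there is a finite set $\mathcal N$ such that for every $h$ there is $n_h$ with $h|_v\in\mathcal N$ for all words $v$ of length at least $n_h$; the minimal such set is the nucleus. The "(possibly infinite) nucleus" is the minimal set with the same property, not required to be finite. The biset of the action is $G\times\{1,2\}$ with elements written $h\cdot x$, left action by multiplication, and right action $(g\cdot x)\cdot h=gh|_x\cdot h(x)$. The biset is called sub-hyperbolic when the action by the faithful quotient is contracting; equivalently, the possibly infinite nucleus contains only finitely many distinct actions. Put $\gamma=\beta^{-1}\alpha^{-1}$, $\delta=\alpha^{-1}\beta^{-1}$. For a set $S$, $S^{\pm1}$ denotes $S$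 together with inverses of its elements; $n$ ranges over $\mathbb Z$. The recursions come from the maps $g$ on moduli space at the indicated fixed points. 1. $g=(1-2z)^2$, fixed point $\frac14$: $\alpha=\langle1,1\rangle\sigma$, $\beta=\langle\alpha,\beta\rangle$; $\mathcal N=\{1,\alpha^n,\beta^n\}$. 2. $g=\frac1{1-(1-2z)^2}$, $\approx-.4196$: $\alpha=\langle1,1\rangle\sigma$, $\beta=\langle\delta,\beta\alpha\beta^{-1}\rangle$; $\mathcal N=\{1,\alpha,\beta,\delta,\beta\alpha\beta^{-1},\delta^2,\alpha^{-1}\beta^{-2},\beta\delta\beta^{-1},\beta\alpha^2\beta\alpha,\delta^{-1}\beta\delta,\delta^{-1}\alpha\beta\delta\}^{\pm1}$. 3. same $g$, $\approx.7098+.3031i$: $\alpha=\langle1,1\rangle\sigma$, $\beta=\langle\alpha,\gamma\rangle$; $\mathcal N=\{1,\alpha,\gamma\}^{\pm1}$. 4. same $g$, $\approx.7098-.3031i$: $\alpha=\langle1,1\rangle\sigma$, $\beta=\langle\alpha,\delta\rangle$; $\mathcal N=\{1,\alpha,\delta\}^{\pm1}$. 5. $g=1-\frac1{(1-2z)^2}$, $1+\frac i2$: $\alpha=\langle1,1\rangle\sigma$, $\beta=\langle\gamma,\beta\rangle$; $\mathcal N=\{1,\alpha^n,\beta^n,\gamma^n,\beta^{-1}\alpha^n\beta,\alpha^n\beta,\alpha\beta^2\}^{\pm1}$. 6. same $g$, $1-\frac i2$: $\alpha=\langle1,1\rangle\sigma$, $\beta=\langle\delta,\beta\rangle$; $\mathcal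 N=\{1,\alpha^n,\beta^n,\delta^n,\beta\alpha^n\beta^{-1},\beta\alpha^n,\beta^2\alpha\}^{\pm1}$. 7. $g=z^2$ (no fixed point outside $\{0,1,\infty\}$; basepoint $\frac14$): $\alpha=\langle1,\alpha\rangle\sigma$, $\beta=\langle\beta,1\rangle$; $\mathcal N=\{1,\alpha,\beta^n,\alpha\beta^n,\alpha\beta^n\alpha^{-1}\}^{\pm1}$. 8. $g=1-z^2$, $\frac12(-1+\sqrt5)$: $\alpha=\langle1,\beta\rangle\sigma$, $\beta=\langle\alpha,1\rangle$; $\mathcal N=\{1,\alpha,\beta,\alpha\beta^{-1}\}^{\pm1}$. 9. same $g$, $\frac12(-1-\sqrt5)$: $\alpha=\langle1,\beta\rangle\sigma$, $\beta=\langle1,\beta\alpha\beta^{-1}\rangle$; $\mathcal N=\{1,\alpha,\beta,\delta,\beta\alpha\beta^{-1}\}^{\pm1}$. 10. $g=\frac1{z^2}$, $\frac12(-1+\sqrt3i)$: $\alpha=\langle1,\delta\rangle\sigma$, $\beta=\langle1,\alpha^{-1}\beta\alpha\rangle$; $\mathcal N=\{1,\alpha,\beta^n,\alpha^{-1}\beta^n\alpha,\beta^n\alpha\}^{\pm1}$. 11. same $g$, $\frac12(-1-\sqrt3i)$: $\alpha=\langle1,\gamma\rangle\sigma$, $\beta=\langle1,\beta\rangle$; $\mathcal N=\{1,\alpha,\beta^n,\gamma\}^{\pm1}$. 12. $g=\frac1{1-z^2}$, real fixed point $\approx-1.3247$: $\alpha=\langle1,\delta\rangle\sigma$, $\beta=\langle1,\alpha\rangle$;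 $\mathcal N=\{1,\alpha,\beta,\delta\}^{\pm1}$. 13. same $g$, $\approx.6624+.5623i$: $\alpha=\langle1,\gamma\rangle\sigma$, $\beta=\langle\alpha,1\rangle$; $\mathcal N=\{1,\alpha,\beta,\gamma\}^{\pm1}$. 14. same $g$, $\approx.6624-.5623i$: $\alpha=\langle1,\delta\rangle\sigma$, $\beta=\langle\alpha,1\rangle$; $\mathcal N=\{1,\alpha,\beta,\delta\}^{\pm1}$.
   Formalization: The listed N is not the minimal nucleus in cases 2, 5, 6, 9, 11, 14; finite image is proved for both the true nucleus and the listed set in all cases, with equality in the other eight, nucleus inside listed set in 9, 11, 14 and listed set inside nucleus in 5, 6. *)

theory Defs
  imports "HOL-Algebra.Coset" "HOL-Algebra.Multiplicative_Group" "HOL-Combinatorics.Transposition"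
begin

section \<open>The free group on a type of generators\<close>

text \<open>
  A letter \<open>(x, True)\<close> is the generator \<open>x\<close>, and \<open>(x, False)\<close> is its inverse.  The elements of
  the free group are the reduced words.
\<close>

type_synonym 'x word = "('x \<times> bool) list"

definition inv_letter :: "'x \<times> bool \<Rightarrow> 'x \<times> bool" where
  "inv_letter l = (fst l, \<not> snd l)"

definition reduced :: "'x word \<Rightarrow> bool" where
  "reduced w \<longleftrightarrow> successively (\<lambda>l m. m \<noteq> inv_letter l) w"

fun push :: "'x \<times> bool \<Rightarrow> 'x word \<Rightarrow> 'x word" where
  "push l [] = [l]"
| "push l (m # w) = (if m = inv_letter l then w else l # m # w)"

definition free_group :: "'x word monoid" where
  "free_group = \<lparr>carrier = {w. reduced w}, mult = (\<lambda>u v. foldr push u v), one = []\<rparr>"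

text \<open>The homomorphism from the free group to \<open>H\<close> extending a map \<open>f\<close> on the generators.\<close>

definition free_lift :: "('h, 'm) monoid_scheme \<Rightarrow> ('x \<Rightarrow> 'h) \<Rightarrow> 'x word \<Rightarrow> 'h" where
  "free_lift H f w =
     foldr (\<lambda>(x, s) y. (if s then f x else inv\<^bsub>H\<^esub> (f x)) \<otimes>\<^bsub>H\<^esub> y) w \<one>\<^bsub>H\<^esub>"

lemma inv_letter_simps [simp]:
  "inv_letter (inv_letter l) = l" "inv_letter l \<noteq> l" "l \<noteq> inv_letter l"
  "inv_letter l = inv_letter m \<longleftrightarrow> l = m"
  by (auto simp: inv_letter_def prod_eq_iff)

lemma reduced_push: "reduced w \<Longrightarrow> reduced (push l w)"
  unfolding reduced_def by (cases w rule: list.exhaust) (auto simp: successively_Cons)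

lemma push_push: "reduced w \<Longrightarrow> push l (push (inv_letter l) w) = w"
  unfolding reduced_def
  by (cases w; cases "tl w") (auto simp: successively_Cons)

lemma reduced_foldr_push: "reduced w \<Longrightarrow> reduced (foldr push u w)"
  by (induction u) (auto intro: reduced_push)

lemma foldr_push_reduced: "reduced u \<Longrightarrow> foldr push u [] = u"
proof (induction u)
  case (Cons l u)
  then show ?case by (cases u) (auto simp: reduced_def successively_Cons)
qed auto

lemma foldr_push_push:
  "reduced w \<Longrightarrow> foldr push (push l u) w = push l (foldr push u w)"
proof (cases u)
  case (Cons m v)
  assume "reduced w"
  then show ?thesis
    using Cons push_push [OF reduced_foldr_push, of w l v] by auto
qed auto

lemma foldr_push_assoc:
  "reduced w \<Longrightarrow> foldr push (foldr push u v) w = foldr push u (foldr push v w)"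
  by (induction u) (auto simp: foldr_push_push)

lemma foldr_push_inverse:
  "reduced w \<Longrightarrow> foldr push (rev (map inv_letter u)) (foldr push u w) = w"
proof (induction u arbitrary: w)
  case (Cons l u)
  have "push (inv_letter l) (push l (foldr push u w)) = foldr push u w"
    using push_push [OF reduced_foldr_push [OF Cons.prems], of "inv_letter l"] by simp
  then show ?case using Cons by simp
qed auto

lemma reduced_inverse: "reduced u \<Longrightarrow> reduced (rev (map inv_letter u))"
  unfolding reduced_def by (auto simp: successively_rev successively_map eq_commute elim: successively_mono)

lemma group_free_group: "group (free_group :: 'x word monoid)"
proof (rule groupI)
  fix u :: "'x word" assume "u \<in> carrier free_group"
  then show "\<exists>v \<in> carrier free_group. v \<otimes>\<^bsub>free_group\<^esub> u = \<one>\<^bsub>free_group\<^esub>"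
    using foldr_push_inverse [of "[]" u] reduced_inverse [of u]
    by (intro bexI [of _ "rev (map inv_letter u)"])
       (auto simp: free_group_def foldr_push_reduced reduced_def)
qed (auto simp: free_group_def reduced_foldr_push foldr_push_assoc, simp add: reduced_def)

lemma free_lift_generator:
  assumes "group H" "f x \<in> carrier H"
  shows "free_lift H f [(x, True)] = f x"
  using assms by (simp add: free_lift_def group.is_monoid)

lemma free_lift_hom:
  assumes H: "group H" and f: "\<And>x. f x \<in> carrier H"
  shows "free_lift H f \<in> hom free_group H"
proof -
  interpret group H by fact
  have closed: "free_lift H f w \<in> carrier H" for w
    by (induction w) (auto simp: free_lift_def f)
  have lift_Cons: "free_lift H f (l # w) = free_lift H f [l] \<otimes>\<^bsub>H\<^esub> free_lift H f w" for l w
    using closed [of w] by (cases l) (auto simp: free_lift_def f)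
  have canc: "free_lift H f [l] \<otimes>\<^bsub>H\<^esub> free_lift H f [inv_letter l] = \<one>\<^bsub>H\<^esub>" for l
    by (cases l) (auto simp: free_lift_def inv_letter_def f)
  have push: "free_lift H f (push l w) = free_lift H f [l] \<otimes>\<^bsub>H\<^esub> free_lift H f w" for l w
  proof (cases "\<exists>v. w = inv_letter l # v")
    case True
    then obtain v where w: "w = inv_letter l # v" by blast
    have "free_lift H f [l] \<otimes>\<^bsub>H\<^esub> free_lift H f w =
        (free_lift H f [l] \<otimes>\<^bsub>H\<^esub> free_lift H f [inv_letter l]) \<otimes>\<^bsub>H\<^esub> free_lift H f v"
      unfolding w lift_Cons [of "inv_letter l" v] by (rule m_assoc [symmetric, OF closed closed closed])
    then show ?thesis by (simp only: canc l_one [OF closed]) (simp add: w)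
  next
    case False
    then have "push l w = l # w" by (cases w) auto
    then show ?thesis by (simp only: lift_Cons [of l w])
  qed
  have "free_lift H f (foldr push u v) = free_lift H f u \<otimes>\<^bsub>H\<^esub> free_lift H f v" for u v
  proof (induction u)
    case Nil then show ?case using closed[of v] by (simp add: free_lift_def)
  next
    case (Cons l u)
    then show ?case using closed by (simp add: push lift_Cons [of l u] m_assoc)
  qed
  then show ?thesis by (auto simp: hom_def closed free_group_def)
qed


section \<open>Self-similar actions on the binary tree\<close>

text \<open>The alphabet \<open>{1,2}\<close>; the vertices of the tree are the lists of letters.\<close>

datatype letter = L1 | L2

definition \<sigma> :: "letter \<Rightarrow> letter" where
  "\<sigma> = transpose L1 L2"

text \<open>
  A pair \<open>(f, p)\<close> stands for \<open>\<langle>f L1, f L2\<rangle>p\<close>.  Permutations act from the right: in the product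
  \<open>p\<close> is applied before \<open>q\<close>.
\<close>

type_synonym 'g wreath = "(letter \<Rightarrow> 'g) \<times> (letter \<Rightarrow> letter)"

definition wreath_product :: "('g, 'm) monoid_scheme \<Rightarrow> 'g wreath monoid" where
  "wreath_product G =
     \<lparr>carrier = {(f, p). (\<forall>x. f x \<in> carrier G) \<and> bij p},
      mult = (\<lambda>(f, p) (h, q). (\<lambda>x. f x \<otimes>\<^bsub>G\<^esub> h (p x), q \<circ> p)),
      one = (\<lambda>x. \<one>\<^bsub>G\<^esub>, id)\<rparr>"

lemma group_wreath_product:
  assumes "group G" shows "group (wreath_product G)"
proof (rule groupI)
  interpret group G by fact
  fix a assume "a \<in> carrier (wreath_product G)"
  then obtain f p where a: "a = (f, p)" "\<And>x. f x \<in> carrier G" "bij p"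
    by (auto simp: wreath_product_def)
  then show "\<exists>b \<in> carrier (wreath_product G).
      b \<otimes>\<^bsub>wreath_product G\<^esub> a = \<one>\<^bsub>wreath_product G\<^esub>"
    by (intro bexI [of _ "(\<lambda>x. inv\<^bsub>G\<^esub> f (Hilbert_Choice.inv p x), Hilbert_Choice.inv p)"])
       (auto simp: wreath_product_def bij_imp_bij_inv fun_eq_iff bij_is_surj surj_f_inv_f)
qed (use assms in \<open>auto simp: wreath_product_def bij_comp fun_eq_iff group.is_monoid
       monoid.m_closed monoid.m_assoc monoid.one_closed monoid.l_one\<close>)

definition wr :: "'g \<Rightarrow> 'g \<Rightarrow> (letter \<Rightarrow> letter) \<Rightarrow> 'g wreath" where
  "wr g h p = (case_letter g h, p)"

text \<open>
  A self-similar action of \<open>G\<close> is given by its wreath recursion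
  \<open>\<psi> h = (\<lambda>x. h|\<^sub>x, \<pi>\<^sub>h)\<close>.
\<close>

fun restriction :: "('g \<Rightarrow> 'g wreath) \<Rightarrow> 'g \<Rightarrow> letter list \<Rightarrow> 'g" where
  "restriction \<psi> h [] = h"
| "restriction \<psi> h (x # v) = restriction \<psi> (fst (\<psi> h) x) v"

fun tree_action :: "('g \<Rightarrow> 'g wreath) \<Rightarrow> 'g \<Rightarrow> letter list \<Rightarrow> letter list" where
  "tree_action \<psi> h [] = []"
| "tree_action \<psi> h (x # v) = snd (\<psi> h) x # tree_action \<psi> (fst (\<psi> h) x) v"

definition absorbing :: "('g, 'm) monoid_scheme \<Rightarrow> ('g \<Rightarrow> 'g wreath) \<Rightarrow> 'g set \<Rightarrow> bool" where
  "absorbing G \<psi> N \<longleftrightarrow> N \<subseteq> carrier G \<and>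
     (\<forall>h \<in> carrier G. \<exists>n. \<forall>v. length v \<ge> n \<longrightarrow> restriction \<psi> h v \<in> N)"

definition contracting :: "('g, 'm) monoid_scheme \<Rightarrow> ('g \<Rightarrow> 'g wreath) \<Rightarrow> bool" where
  "contracting G \<psi> \<longleftrightarrow> (\<exists>N. finite N \<and> absorbing G \<psi> N)"

text \<open>
  The possibly infinite nucleus.  Absorbing sets are closed under binary intersections, so a
  minimal one is a least one.
\<close>

definition is_nucleus :: "('g, 'm) monoid_scheme \<Rightarrow> ('g \<Rightarrow> 'g wreath) \<Rightarrow> 'g set \<Rightarrow> bool" where
  "is_nucleus G \<psi> N \<longleftrightarrow> absorbing G \<psi> N \<and> (\<forall>M. absorbing G \<psi> M \<longrightarrow> N \<subseteq> M)"

lemma absorbing_Int: "absorbing G \<psi> M \<Longrightarrow> absorbing G \<psi> N \<Longrightarrow> absorbing G \<psi> (M \<inter> N)"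
  unfolding absorbing_def by (metis IntI le_trans linear inf.coboundedI1)

definition action_kernel :: "('g, 'm) monoid_scheme \<Rightarrow> ('g \<Rightarrow> 'g wreath) \<Rightarrow> 'g set" where
  "action_kernel G \<psi> = {h \<in> carrier G. \<forall>v. tree_action \<psi> h v = v}"

definition faithful_quotient ::
    "('g, 'm) monoid_scheme \<Rightarrow> ('g \<Rightarrow> 'g wreath) \<Rightarrow> 'g set monoid" where
  "faithful_quotient G \<psi> = G Mod action_kernel G \<psi>"

definition to_quotient :: "('g, 'm) monoid_scheme \<Rightarrow> ('g \<Rightarrow> 'g wreath) \<Rightarrow> 'g \<Rightarrow> 'g set" where
  "to_quotient G \<psi> g = action_kernel G \<psi> #>\<^bsub>G\<^esub> g"

text \<open>
  The wreath recursion induced on the faithful quotient; the sets below are singletons since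
  elements of one coset have the same action on the tree.
\<close>

definition quotient_recursion ::
    "('g, 'm) monoid_scheme \<Rightarrow> ('g \<Rightarrow> 'g wreath) \<Rightarrow> 'g set \<Rightarrow> 'g set wreath" where
  "quotient_recursion G \<psi> C =
     (\<lambda>x. the_elem ((\<lambda>g. to_quotient G \<psi> (fst (\<psi> g) x)) ` C),
      the_elem ((\<lambda>g. snd (\<psi> g)) ` C))"


section \<open>Bisets\<close>

record ('g, 'b) biset =
  points :: "'b set"
  left_act :: "'g \<Rightarrow> 'b \<Rightarrow> 'b"
  right_act :: "'b \<Rightarrow> 'g \<Rightarrow> 'b"

definition action_biset ::
    "('g, 'm) monoid_scheme \<Rightarrow> ('g \<Rightarrow> 'g wreath) \<Rightarrow> ('g, 'g \<times> letter) biset" where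
  "action_biset G \<psi> =
     \<lparr>points = carrier G \<times> UNIV,
      left_act = (\<lambda>h (g, x). (h \<otimes>\<^bsub>G\<^esub> g, x)),
      right_act = (\<lambda>(g, x) h. (g \<otimes>\<^bsub>G\<^esub> fst (\<psi> h) x, snd (\<psi> h) x))\<rparr>"

text \<open>
  The biset determines the recursion through the basis \<open>1 \<cdot> x\<close>, as
  \<open>(1 \<cdot> x) \<cdot> h = h|\<^sub>x \<cdot> h(x)\<close>.
\<close>

definition biset_recursion ::
    "('g, 'm) monoid_scheme \<Rightarrow> ('g, 'g \<times> letter) biset \<Rightarrow> 'g \<Rightarrow> 'g wreath" where
  "biset_recursion G B h =
     (\<lambda>x. fst (right_act B (\<one>\<^bsub>G\<^esub>, x) h), \<lambda>x. snd (right_act B (\<one>\<^bsub>G\<^esub>, x) h))"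

definition sub_hyperbolic ::
    "('g, 'm) monoid_scheme \<Rightarrow> ('g, 'g \<times> letter) biset \<Rightarrow> bool" where
  "sub_hyperbolic G B \<longleftrightarrow>
     contracting (faithful_quotient G (biset_recursion G B))
       (quotient_recursion G (biset_recursion G B))"


text \<open>The kernel is normal, and the two induced recursions above are well defined.\<close>

context
  fixes G :: "('g, 'm) monoid_scheme" and \<psi>
  assumes G: "group G" and hom: "\<psi> \<in> hom G (wreath_product G)"
begin

lemma wreath_closed: "h \<in> carrier G \<Longrightarrow> fst (\<psi> h) x \<in> carrier G"
  using hom by (force simp: hom_def wreath_product_def Pi_def)

lemma wreath_mult:
  assumes "g \<in> carrier G" "h \<in> carrier G"
  shows "snd (\<psi> (g \<otimes>\<^bsub>G\<^esub> h)) x = snd (\<psi> h) (snd (\<psi> g) x)"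
    "fst (\<psi> (g \<otimes>\<^bsub>G\<^esub> h)) x = fst (\<psi> g) x \<otimes>\<^bsub>G\<^esub> fst (\<psi> h) (snd (\<psi> g) x)"
proof -
  have "\<psi> (g \<otimes>\<^bsub>G\<^esub> h) = \<psi> g \<otimes>\<^bsub>wreath_product G\<^esub> \<psi> h"
    using hom assms by (simp add: hom_def)
  then show "snd (\<psi> (g \<otimes>\<^bsub>G\<^esub> h)) x = snd (\<psi> h) (snd (\<psi> g) x)"
    "fst (\<psi> (g \<otimes>\<^bsub>G\<^esub> h)) x = fst (\<psi> g) x \<otimes>\<^bsub>G\<^esub> fst (\<psi> h) (snd (\<psi> g) x)"
    by (auto simp: wreath_product_def split: prod.splits)
qed

lemma wreath_one: "snd (\<psi> \<one>\<^bsub>G\<^esub>) x = x" "fst (\<psi> \<one>\<^bsub>G\<^esub>) x = \<one>\<^bsub>G\<^esub>"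
proof -
  have "\<psi> \<one>\<^bsub>G\<^esub> = \<one>\<^bsub>wreath_product G\<^esub>"
    using hom_one [OF hom G group_wreath_product [OF G]] .
  then show "snd (\<psi> \<one>\<^bsub>G\<^esub>) x = x" "fst (\<psi> \<one>\<^bsub>G\<^esub>) x = \<one>\<^bsub>G\<^esub>"
    by (auto simp: wreath_product_def)
qed

lemma tree_action_mult:
  "g \<in> carrier G \<Longrightarrow> h \<in> carrier G \<Longrightarrow>
    tree_action \<psi> (g \<otimes>\<^bsub>G\<^esub> h) v = tree_action \<psi> h (tree_action \<psi> g v)"
  by (induction v arbitrary: g h) (auto simp: wreath_mult wreath_closed)

lemma tree_action_one: "tree_action \<psi> \<one>\<^bsub>G\<^esub> v = v"
  by (induction v) (auto simp: wreath_one)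

lemma tree_action_inv:
  assumes "h \<in> carrier G"
  shows "tree_action \<psi> (inv\<^bsub>G\<^esub> h) (tree_action \<psi> h v) = v"
    "tree_action \<psi> h (tree_action \<psi> (inv\<^bsub>G\<^esub> h) v) = v"
  using assms tree_action_mult [of h "inv\<^bsub>G\<^esub> h" v] tree_action_mult [of "inv\<^bsub>G\<^esub> h" h v]
  by (simp_all add: tree_action_one G group.r_inv group.l_inv group.inv_closed)

lemma normal_action_kernel: "action_kernel G \<psi> \<lhd> G"
proof -
  interpret group G by (rule G)
  have sub: "subgroup (action_kernel G \<psi>) G"
    by (rule subgroupI)
       (auto simp: action_kernel_def tree_action_mult tree_action_one
             intro: exI [of _ "\<one>\<^bsub>G\<^esub>"], metis tree_action_inv(1))
  show ?thesis
    by (rule normal_invI [OF sub])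
       (auto simp: action_kernel_def tree_action_mult tree_action_inv)
qed

lemma to_quotient_eq_iff:
  assumes "g \<in> carrier G" "h \<in> carrier G"
  shows "to_quotient G \<psi> g = to_quotient G \<psi> h \<longleftrightarrow> (\<forall>v. tree_action \<psi> g v = tree_action \<psi> h v)"
proof -
  interpret group G by (rule G)
  interpret normal "action_kernel G \<psi>" G by (rule normal_action_kernel)
  have "to_quotient G \<psi> g = to_quotient G \<psi> h \<longleftrightarrow> g \<otimes>\<^bsub>G\<^esub> inv\<^bsub>G\<^esub> h \<in> action_kernel G \<psi>"
    unfolding to_quotient_def
    using rcos_module [OF is_group assms(2,1)] rcos_self [OF assms(1) is_subgroup]
      repr_independence [OF _ assms(2) is_subgroup, of g] by blast
  also have "\<dots> \<longleftrightarrow> (\<forall>v. tree_action \<psi> g v = tree_action \<psi> h v)"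
  proof -
    have "tree_action \<psi> (inv\<^bsub>G\<^esub> h) (tree_action \<psi> g v) = v \<longleftrightarrow>
        tree_action \<psi> g v = tree_action \<psi> h v" for v
    proof
      assume "tree_action \<psi> (inv\<^bsub>G\<^esub> h) (tree_action \<psi> g v) = v"
      then have "tree_action \<psi> h (tree_action \<psi> (inv\<^bsub>G\<^esub> h) (tree_action \<psi> g v)) = tree_action \<psi> h v"
        by (rule arg_cong)
      then show "tree_action \<psi> g v = tree_action \<psi> h v"
        unfolding tree_action_inv(2) [OF assms(2)] .
    next
      assume "tree_action \<psi> g v = tree_action \<psi> h v"
      then show "tree_action \<psi> (inv\<^bsub>G\<^esub> h) (tree_action \<psi> g v) = v"
        by (simp only: tree_action_inv(1) [OF assms(2)])
    qed
    moreover have "g \<otimes>\<^bsub>G\<^esub> inv\<^bsub>G\<^esub> h \<in> carrier G" "inv\<^bsub>G\<^esub> h \<in> carrier G"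
      using assms by auto
    ultimately show ?thesis
      unfolding action_kernel_def by (simp only: mem_Collect_eq tree_action_mult assms simp_thms)
  qed
  finally show ?thesis .
qed

lemma quotient_recursion_to_quotient:
  assumes h: "h \<in> carrier G"
  shows "quotient_recursion G \<psi> (to_quotient G \<psi> h) =
    (\<lambda>x. to_quotient G \<psi> (fst (\<psi> h) x), snd (\<psi> h))"
proof -
  interpret group G by (rule G)
  interpret normal "action_kernel G \<psi>" G by (rule normal_action_kernel)
  have ne: "h \<in> to_quotient G \<psi> h"
    unfolding to_quotient_def by (rule rcos_self [OF h is_subgroup])
  have g: "(\<forall>x. to_quotient G \<psi> (fst (\<psi> g) x) = to_quotient G \<psi> (fst (\<psi> h) x)) \<and>
           snd (\<psi> g) = snd (\<psi> h)" if "g \<in> to_quotient G \<psi> h" for g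
  proof -
    have gc: "g \<in> carrier G" and eq: "to_quotient G \<psi> g = to_quotient G \<psi> h"
      using that h r_coset_subset_G [OF subset h] repr_independence [OF _ h is_subgroup]
      unfolding to_quotient_def by auto
    then have *: "tree_action \<psi> g (x # v) = tree_action \<psi> h (x # v)" for x v
      using to_quotient_eq_iff h by blast
    then show ?thesis
      using gc h by (auto simp: to_quotient_eq_iff wreath_closed)
  qed
  have "(\<lambda>g. to_quotient G \<psi> (fst (\<psi> g) x)) ` to_quotient G \<psi> h =
      (\<lambda>_. to_quotient G \<psi> (fst (\<psi> h) x)) ` to_quotient G \<psi> h" for x
    by (rule image_cong [OF refl]) (use g in blast)
  moreover have "(\<lambda>g. snd (\<psi> g)) ` to_quotient G \<psi> h = (\<lambda>_. snd (\<psi> h)) ` to_quotient G \<psi> h"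
    by (rule image_cong [OF refl]) (use g in blast)
  ultimately show ?thesis
    unfolding quotient_recursion_def by (simp only: image_constant [OF ne] the_elem_eq)
qed

lemma biset_recursion_action_biset:
  "h \<in> carrier G \<Longrightarrow> biset_recursion G (action_biset G \<psi>) h = \<psi> h"
  using G by (simp add: biset_recursion_def action_biset_def wreath_closed group.is_monoid monoid.l_one)

end


section \<open>The fourteen actions\<close>

datatype gen = Gen_alpha | Gen_beta

abbreviation F2 :: "gen word monoid" where
  "F2 \<equiv> free_group"

abbreviation F2_mult :: "gen word \<Rightarrow> gen word \<Rightarrow> gen word" (infixl \<open>\<cdot>\<close> 70) where
  "g \<cdot> h \<equiv> g \<otimes>\<^bsub>F2\<^esub> h"

abbreviation F2_pow :: "gen word \<Rightarrow> int \<Rightarrow> gen word" (infixr \<open>\<up>\<close> 75) where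
  "g \<up> n \<equiv> g [^]\<^bsub>F2\<^esub> n"

definition \<alpha> :: "gen word" where "\<alpha> = [(Gen_alpha, True)]"

definition \<beta> :: "gen word" where "\<beta> = [(Gen_beta, True)]"

abbreviation \<alpha>' :: "gen word" where "\<alpha>' \<equiv> inv\<^bsub>F2\<^esub> \<alpha>"

abbreviation \<beta>' :: "gen word" where "\<beta>' \<equiv> inv\<^bsub>F2\<^esub> \<beta>"

definition \<gamma> :: "gen word" where "\<gamma> = \<beta>' \<cdot> \<alpha>'"

definition \<delta> :: "gen word" where "\<delta> = \<alpha>' \<cdot> \<beta>'"

abbreviation \<epsilon> :: "gen word" where "\<epsilon> \<equiv> \<one>\<^bsub>F2\<^esub>"

definition pm :: "gen word set \<Rightarrow> gen word set" where
  "pm S = S \<union> (\<lambda>g. inv\<^bsub>F2\<^esub> g) ` S"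

text \<open>The images of \<open>\<alpha>\<close> and of \<open>\<beta>\<close> under the \<open>i\<close>-th wreath recursion, for \<open>i = 1, \<dots>, 14\<close>.\<close>

definition gen_images :: "nat \<Rightarrow> gen word wreath \<times> gen word wreath" where
  "gen_images = (\<lambda>_. undefined)(
     1 := (wr \<epsilon> \<epsilon> \<sigma>, wr \<alpha> \<beta> id),
     2 := (wr \<epsilon> \<epsilon> \<sigma>, wr \<delta> (\<beta> \<cdot> \<alpha> \<cdot> \<beta>') id),
     3 := (wr \<epsilon> \<epsilon> \<sigma>, wr \<alpha> \<gamma> id),
     4 := (wr \<epsilon> \<epsilon> \<sigma>, wr \<alpha> \<delta> id),
     5 := (wr \<epsilon> \<epsilon> \<sigma>, wr \<gamma> \<beta> id),
     6 := (wr \<epsilon> \<epsilon> \<sigma>, wr \<delta> \<beta> id),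
     7 := (wr \<epsilon> \<alpha> \<sigma>, wr \<beta> \<epsilon> id),
     8 := (wr \<epsilon> \<beta> \<sigma>, wr \<alpha> \<epsilon> id),
     9 := (wr \<epsilon> \<beta> \<sigma>, wr \<epsilon> (\<beta> \<cdot> \<alpha> \<cdot> \<beta>') id),
     10 := (wr \<epsilon> \<delta> \<sigma>, wr \<epsilon> (\<alpha>' \<cdot> \<beta> \<cdot> \<alpha>) id),
     11 := (wr \<epsilon> \<gamma> \<sigma>, wr \<epsilon> \<beta> id),
     12 := (wr \<epsilon> \<delta> \<sigma>, wr \<epsilon> \<alpha> id),
     13 := (wr \<epsilon> \<gamma> \<sigma>, wr \<alpha> \<epsilon> id),
     14 := (wr \<epsilon> \<delta> \<sigma>, wr \<alpha> \<epsilon> id))"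

definition recursion :: "nat \<Rightarrow> gen word \<Rightarrow> gen word wreath" where
  "recursion i =
     free_lift (wreath_product F2)
       (case_gen (fst (gen_images i)) (snd (gen_images i)))"

lemma recursion_hom:
  assumes "i \<in> {1..14}"
  shows "recursion i \<in> hom F2 (wreath_product F2)"
    and "recursion i \<alpha> = fst (gen_images i)"
    and "recursion i \<beta> = snd (gen_images i)"
proof -
  interpret F2: group F2 by (rule group_free_group)
  have ab: "\<alpha> \<in> carrier F2" "\<beta> \<in> carrier F2"
    by (simp_all add: \<alpha>_def \<beta>_def free_group_def reduced_def)
  have wr: "wr g h p \<in> carrier (wreath_product F2)"
    if "g \<in> carrier F2" "h \<in> carrier F2" "bij p" for g h p
    using that by (auto simp: wr_def wreath_product_def split: letter.split)
  have "bij \<sigma>" by (simp add: \<sigma>_def)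
  have "i = 1 \<or> i = 2 \<or> i = 3 \<or> i = 4 \<or> i = 5 \<or> i = 6 \<or> i = 7 \<or>
      i = 8 \<or> i = 9 \<or> i = 10 \<or> i = 11 \<or> i = 12 \<or> i = 13 \<or> i = 14"
    using assms by (simp add: atLeastAtMost_iff) presburger
  then have "fst (gen_images i) \<in> carrier (wreath_product F2) \<and>
      snd (gen_images i) \<in> carrier (wreath_product F2)"
    by (elim disjE) (simp_all add: gen_images_def \<gamma>_def \<delta>_def wr ab \<open>bij \<sigma>\<close>)
  then have images: "case_gen (fst (gen_images i)) (snd (gen_images i)) x
      \<in> carrier (wreath_product F2)" for x
    by (cases x) auto
  note lift = free_lift_hom free_lift_generator
  show "recursion i \<in> hom F2 (wreath_product F2)"
    unfolding recursion_def by (intro lift group_wreath_product group_free_group images)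
  show "recursion i \<alpha> = fst (gen_images i)" "recursion i \<beta> = snd (gen_images i)"
    unfolding recursion_def \<alpha>_def \<beta>_def
    using images [of Gen_alpha] images [of Gen_beta]
    by (simp_all add: lift group_wreath_product group_free_group)
qed

text \<open>
  The sets as printed in the source.  They differ from the least absorbing set in six cases:
  for \<open>i = 9, 11, 14\<close> the printed set contains transient elements (respectively
  \<open>\<alpha>\<close> and \<open>\<beta>\<close>; \<open>\<alpha>\<close>; \<open>\<beta>\<close>, with inverses), for \<open>i = 5, 6\<close> it lacks some recurrent elements such as
  \<open>\<alpha> \<cdot> \<beta> \<cdot> \<alpha>\<close>, and for \<open>i = 2\<close> both discrepancies occur.
\<close>

definition listed_nucleus :: "nat \<Rightarrow> gen word set" where
  "listed_nucleus = (\<lambda>_. undefined)(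
     1 := {\<epsilon>} \<union> (\<Union>n. {\<alpha> \<up> n, \<beta> \<up> n}),
     2 := pm {\<epsilon>, \<alpha>, \<beta>, \<delta>, \<beta> \<cdot> \<alpha> \<cdot> \<beta>', \<delta> \<up> 2, \<alpha>' \<cdot> \<beta> \<up> (-2), \<beta> \<cdot> \<delta> \<cdot> \<beta>',
              \<beta> \<cdot> \<alpha> \<up> 2 \<cdot> \<beta> \<cdot> \<alpha>, inv\<^bsub>F2\<^esub> \<delta> \<cdot> \<beta> \<cdot> \<delta>, inv\<^bsub>F2\<^esub> \<delta> \<cdot> \<alpha> \<cdot> \<beta> \<cdot> \<delta>},
     3 := pm {\<epsilon>, \<alpha>, \<gamma>},
     4 := pm {\<epsilon>, \<alpha>, \<delta>},
     5 := pm ({\<epsilon>, \<alpha> \<cdot> \<beta> \<up> 2} \<union>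
            (\<Union>n. {\<alpha> \<up> n, \<beta> \<up> n, \<gamma> \<up> n, \<beta>' \<cdot> \<alpha> \<up> n \<cdot> \<beta>, \<alpha> \<up> n \<cdot> \<beta>})),
     6 := pm ({\<epsilon>, \<beta> \<up> 2 \<cdot> \<alpha>} \<union>
            (\<Union>n. {\<alpha> \<up> n, \<beta> \<up> n, \<delta> \<up> n, \<beta> \<cdot> \<alpha> \<up> n \<cdot> \<beta>', \<beta> \<cdot> \<alpha> \<up> n})),
     7 := pm ({\<epsilon>, \<alpha>} \<union> (\<Union>n. {\<beta> \<up> n, \<alpha> \<cdot> \<beta> \<up> n, \<alpha> \<cdot> \<beta> \<up> n \<cdot> \<alpha>'})),
     8 := pm {\<epsilon>, \<alpha>, \<beta>, \<alpha> \<cdot> \<beta>'},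
     9 := pm {\<epsilon>, \<alpha>, \<beta>, \<delta>, \<beta> \<cdot> \<alpha> \<cdot> \<beta>'},
     10 := pm ({\<epsilon>, \<alpha>} \<union> (\<Union>n. {\<beta> \<up> n, \<alpha>' \<cdot> \<beta> \<up> n \<cdot> \<alpha>, \<beta> \<up> n \<cdot> \<alpha>})),
     11 := pm ({\<epsilon>, \<alpha>, \<gamma>} \<union> (\<Union>n. {\<beta> \<up> n})),
     12 := pm {\<epsilon>, \<alpha>, \<beta>, \<delta>},
     13 := pm {\<epsilon>, \<alpha>, \<beta>, \<gamma>},
     14 := pm {\<epsilon>, \<alpha>, \<beta>, \<delta>})"

end

theory Submission
  imports Defs
begin

text \<open>
  Call an element recurrent if some element of the group has it as a restriction at arbitrarily
  deep vertices.  Every absorbing set contains the recurrent elements.  Conversely, the generators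
  of each of the fourteen recursions have finitely many restrictions, and so does every element,
  since restrictions multiply.  An element with finitely many restrictions can meet a
  non-recurrent one only at bounded depth, so the recurrent elements are absorbing: they are
  the nucleus (\<open>is_nucleus_recurrent\<close>).

  If some absorbing set \<open>M\<close> has finite image in the faithful quotient, then so does the nucleus,
  being contained in \<open>M\<close>, and the image of \<open>M\<close> is a finite absorbing set of the quotient, which is
  therefore contracting (\<open>nucleus_finite_in_quotient\<close>).  It remains to find such an \<open>M\<close> for each
  recursion.  There are three situations.

  For \<open>i = 2, 3, 4, 8, 9, 12, 13, 14\<close> there is a finite \<open>M\<close>.  A set is absorbing if it
  swallows, from some level on, the restrictions of all products of a restriction of a generator
  with one of its elements: then one can read a word letter by letter
  (\<open>absorbing_if_products\<close>).  For finite sets this is a computation with words.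

  For \<open>i = 1, 7, 10, 11\<close> the set \<open>M\<close> consists of families such as \<open>\<alpha> \<cdot> \<beta>\<^sup>n\<close>, and the same criterion is
  checked with \<open>n\<close> as a parameter.  In the quotient \<open>\<beta>\<close> becomes trivial or, for \<open>i = 1\<close>, both
  generators become involutions, so each family has finite image (\<open>finite_image_powers\<close>).

  For \<open>i = 5, 6\<close> the action factors through a group of isometries of the complex plane, generated
  by \<open>z \<mapsto> 1 - z\<close> and \<open>z \<mapsto> \<i> z\<close>, which preserves the Gaussian integers.  Passing to a restriction
  divides by a Gaussian integer of norm \<open>2\<close>, as for Lattes maps, so it
  shrinks translations; words with short translation form an absorbing set, and they induce only
  finitely many isometries (\<open>absorbing_bounded_words\<close>, \<open>finite_image_bounded_words\<close>).

  That a listed element is recurrent is seen by walking backwards: each element of a finite set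
  \<open>R\<close> is recurrent if each is a restriction at a letter of some element of \<open>R\<close>
  (\<open>recurrent_if_predecessors\<close>).
\<close>

section \<open>Recurrent elements and the faithful quotient\<close>

definition recurrent :: "('g, 'm) monoid_scheme \<Rightarrow> ('g \<Rightarrow> 'g wreath) \<Rightarrow> 'g set" where
  "recurrent G \<psi> =
     {g. \<exists>h \<in> carrier G. \<forall>n. \<exists>v. n \<le> length v \<and> restriction \<psi> h v = g}"

lemma restriction_append:
  "restriction \<psi> h (u @ v) = restriction \<psi> (restriction \<psi> h u) v"
  by (induction u arbitrary: h) auto

lemma length_tree_action [simp]: "length (tree_action \<psi> h v) = length v"
  by (induction v arbitrary: h) auto

lemma recurrent_subset_absorbing:
  assumes "absorbing G \<psi> M" shows "recurrent G \<psi> \<subseteq> M"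
  using assms unfolding absorbing_def recurrent_def by blast

lemma restriction_recurrent:
  assumes "g \<in> recurrent G \<psi>" shows "restriction \<psi> g v \<in> recurrent G \<psi>"
proof -
  obtain h where h: "h \<in> carrier G" "\<And>n. \<exists>u. n \<le> length u \<and> restriction \<psi> h u = g"
    using assms unfolding recurrent_def by blast
  have "\<exists>u. n \<le> length u \<and> restriction \<psi> h u = restriction \<psi> g v" for n
  proof -
    obtain u where "n \<le> length u" "restriction \<psi> h u = g" using h(2) by blast
    then show ?thesis by (intro exI [of _ "u @ v"]) (simp add: restriction_append)
  qed
  then show ?thesis using h(1) unfolding recurrent_def by blast
qed

lemma section_recurrent: "g \<in> recurrent G \<psi> \<Longrightarrow> fst (\<psi> g) x \<in> recurrent G \<psi>"
  using restriction_recurrent [of g G \<psi> "[x]"] by simp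

text \<open>
  Going backwards from \<open>g\<close> through \<open>R\<close> yields, for each \<open>n\<close>, an element of \<open>R\<close> with \<open>g\<close> as a
  restriction at depth \<open>n\<close>; as \<open>R\<close> is finite, one element serves infinitely many \<open>n\<close>.
\<close>

lemma recurrent_if_predecessors:
  assumes R: "finite R" "R \<subseteq> carrier G"
    and pre: "\<And>g. g \<in> R \<Longrightarrow> \<exists>h \<in> R. \<exists>x. fst (\<psi> h) x = g"
  shows "R \<subseteq> recurrent G \<psi>"
proof
  fix g assume g: "g \<in> R"
  have "\<exists>h \<in> R. \<exists>v. length v = n \<and> restriction \<psi> h v = g" for n
  proof (induction n)
    case 0
    then show ?case using g by (auto intro!: bexI [of _ g])
  next
    case (Suc n)
    then obtain h v where h: "h \<in> R" "length v = n" "restriction \<psi> h v = g" by blast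
    then obtain k x where "k \<in> R" "fst (\<psi> k) x = h" using pre by blast
    then show ?case using h by (intro bexI [of _ k] exI [of _ "x # v"]) auto
  qed
  then obtain f where f: "\<And>n. f n \<in> R"
      "\<And>n. \<exists>v. length v = n \<and> restriction \<psi> (f n) v = g"
    by metis
  have "finite (range f)" using f(1) R(1) by (meson finite_subset image_subsetI)
  then obtain m where m: "infinite {n. f n = f m}"
    using pigeonhole_infinite [of "UNIV :: nat set" f] by auto
  have "\<exists>v. n \<le> length v \<and> restriction \<psi> (f m) v = g" for n
  proof -
    obtain k where "n \<le> k" "f k = f m"
      using m unfolding infinite_nat_iff_unbounded_le by blast
    then show ?thesis using f(2) [of k] by auto
  qed
  then show "g \<in> recurrent G \<psi>" using f(1) [of m] R(2) unfolding recurrent_def by blast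
qed

lemma recurrent_if_mutual:
  assumes "g \<in> carrier G" "h \<in> carrier G" "fst (\<psi> g) x = h" "fst (\<psi> h) y = g"
  shows "g \<in> recurrent G \<psi>" "h \<in> recurrent G \<psi>"
  using recurrent_if_predecessors [of "{g, h}" G \<psi>] assms by auto

text \<open>
  This allows equality of actions to be proved by exhibiting a relation that the two recursions
  preserve.
\<close>

lemma tree_action_bisim:
  assumes "R g h"
    and "\<And>g h x. R g h \<Longrightarrow> snd (\<psi> g) x = snd (\<phi> h) x \<and> R (fst (\<psi> g) x) (fst (\<phi> h) x)"
  shows "tree_action \<psi> g v = tree_action \<phi> h v"
  using assms(1) by (induction v arbitrary: g h) (use assms(2) in auto)


locale self_similar_action = group G for G :: "('g, 'm) monoid_scheme" (structure) +
  fixes \<psi> :: "'g \<Rightarrow> 'g wreath"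
  assumes hom: "\<psi> \<in> hom G (wreath_product G)"
begin

lemmas section_closed [simp, intro] = wreath_closed [OF is_group hom]
lemmas section_mult = wreath_mult [OF is_group hom]
lemmas section_one [simp] = wreath_one [OF is_group hom]
lemmas same_coset_iff = to_quotient_eq_iff [OF is_group hom]

lemma restriction_closed [simp, intro]: "h \<in> carrier G \<Longrightarrow> restriction \<psi> h v \<in> carrier G"
  by (induction v arbitrary: h) auto

lemma restriction_mult:
  "g \<in> carrier G \<Longrightarrow> h \<in> carrier G \<Longrightarrow>
    restriction \<psi> (g \<otimes> h) v = restriction \<psi> g v \<otimes> restriction \<psi> h (tree_action \<psi> g v)"
  by (induction v arbitrary: g h) (auto simp: section_mult)

lemma restriction_one [simp]: "restriction \<psi> \<one> v = \<one>"
  by (induction v) auto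

lemma restriction_inv:
  assumes "h \<in> carrier G"
  shows "restriction \<psi> (inv h) (tree_action \<psi> h v) = inv (restriction \<psi> h v)"
proof -
  have "restriction \<psi> h v \<otimes> restriction \<psi> (inv h) (tree_action \<psi> h v) = \<one>"
    using restriction_mult [of h "inv h" v] assms by simp
  then show ?thesis using assms by (metis inv_closed inv_equality inv_inv restriction_closed)
qed

lemma section_inv:
  assumes "h \<in> carrier G"
  shows "fst (\<psi> (inv h)) (snd (\<psi> h) x) = inv (fst (\<psi> h) x)"
    "snd (\<psi> (inv h)) (snd (\<psi> h) x) = x"
  using restriction_inv [OF assms, of "[x]"] section_mult(1) [of h "inv h" x] assms by auto

text \<open>Restriction to a fixed letter is a homomorphism on the stabiliser of that letter.\<close>

lemma section_pow_fixed:
  assumes g: "g \<in> carrier G" "snd (\<psi> g) x = x"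
  shows "snd (\<psi> (g [^] (n::int))) x = x \<and> fst (\<psi> (g [^] n)) x = fst (\<psi> g) x [^] n"
proof -
  have nat: "snd (\<psi> (g [^] (k::nat))) x = x \<and> fst (\<psi> (g [^] k)) x = fst (\<psi> g) x [^] k" for k
    by (induction k) (use g in \<open>auto simp: section_mult\<close>)
  show ?thesis
  proof (cases n)
    case (nonneg k)
    then show ?thesis using nat [of k] by (simp add: int_pow_int)
  next
    case (neg k)
    have "g [^] n = inv (g [^] Suc k)" for g
      using neg by (simp add: int_pow_def2 nat_add_distrib)
    moreover have "fst (\<psi> (inv (g [^] Suc k))) x = inv (fst (\<psi> g) x [^] Suc k)"
      "snd (\<psi> (inv (g [^] Suc k))) x = x"
      using section_inv [of "g [^] Suc k" x] nat [of "Suc k"] g by (auto simp del: nat_pow_Suc)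
    ultimately show ?thesis by simp
  qed
qed

lemma recurrent_closed: "g \<in> recurrent G \<psi> \<Longrightarrow> g \<in> carrier G"
  unfolding recurrent_def by auto

lemma recurrent_inv:
  assumes "g \<in> recurrent G \<psi>" shows "inv g \<in> recurrent G \<psi>"
proof -
  obtain h where h: "h \<in> carrier G" "\<And>n. \<exists>u. n \<le> length u \<and> restriction \<psi> h u = g"
    using assms unfolding recurrent_def by blast
  have "\<exists>u. n \<le> length u \<and> restriction \<psi> (inv h) u = inv g" for n
    using h(2) [of n] restriction_inv [OF h(1)] length_tree_action by metis
  then show ?thesis using h(1) unfolding recurrent_def by blast
qed

lemma recurrent_inv_iff:
  "g \<in> carrier G \<Longrightarrow> inv g \<in> recurrent G \<psi> \<longleftrightarrow> g \<in> recurrent G \<psi>"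
  using recurrent_inv [of g] recurrent_inv [of "inv g"] by auto

lemma finite_states_mult:
  assumes "g \<in> carrier G" "h \<in> carrier G"
    and "finite (range (restriction \<psi> g))" "finite (range (restriction \<psi> h))"
  shows "finite (range (restriction \<psi> (g \<otimes> h)))"
proof (rule finite_subset)
  show "range (restriction \<psi> (g \<otimes> h)) \<subseteq>
      (\<lambda>(a, b). a \<otimes> b) ` (range (restriction \<psi> g) \<times> range (restriction \<psi> h))"
    using assms by (auto simp: restriction_mult)
  show "finite ((\<lambda>(a, b). a \<otimes> b) ` (range (restriction \<psi> g) \<times> range (restriction \<psi> h)))"
    using assms by blast
qed

text \<open>
  The non-recurrent restrictions of \<open>h\<close> form a finite set \<open>B\<close>, and each \<open>g \<in> B\<close> occurs only below
  some depth \<open>f g\<close>; the sum of these depths bounds all of them.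
\<close>

lemma is_nucleus_recurrent:
  assumes fin: "\<And>h. h \<in> carrier G \<Longrightarrow> finite (range (restriction \<psi> h))"
  shows "is_nucleus G \<psi> (recurrent G \<psi>)"
  unfolding is_nucleus_def
proof (intro conjI allI impI)
  show "absorbing G \<psi> (recurrent G \<psi>)"
    unfolding absorbing_def
  proof (intro conjI ballI)
    show "recurrent G \<psi> \<subseteq> carrier G" using recurrent_closed by blast
    fix h assume h: "h \<in> carrier G"
    define B where "B = range (restriction \<psi> h) - recurrent G \<psi>"
    have "finite B" using fin [OF h] by (simp add: B_def)
    have "\<forall>g \<in> B. \<exists>n. \<forall>v. n \<le> length v \<longrightarrow> restriction \<psi> h v \<noteq> g"
      using h unfolding B_def recurrent_def by blast
    then obtain f where f: "\<forall>g \<in> B. \<forall>v. f g \<le> length v \<longrightarrow> restriction \<psi> h v \<noteq> g"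
      unfolding bchoice_iff by blast
    have "restriction \<psi> h v \<notin> B" if v: "sum f B \<le> length v" for v
    proof
      assume B: "restriction \<psi> h v \<in> B"
      then have "f (restriction \<psi> h v) \<le> sum f B"
        using \<open>finite B\<close> by (simp add: member_le_sum)
      then have "f (restriction \<psi> h v) \<le> length v"
        using v by (rule le_trans)
      then show False using f B by blast
    qed
    then show "\<exists>n. \<forall>v. n \<le> length v \<longrightarrow> restriction \<psi> h v \<in> recurrent G \<psi>"
      unfolding B_def by blast
  qed
qed (rule recurrent_subset_absorbing)

lemma same_coset_kernel_mult:
  assumes "u \<in> carrier G" "k \<in> action_kernel G \<psi>" "h \<in> carrier G" "w \<in> carrier G"
  shows "to_quotient G \<psi> (u \<otimes> (k \<otimes> h) \<otimes> w) = to_quotient G \<psi> (u \<otimes> h \<otimes> w)"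
proof -
  have "k \<in> carrier G" "\<And>v. tree_action \<psi> k v = v"
    using assms(2) by (auto simp: action_kernel_def)
  then show ?thesis
    using assms by (simp add: same_coset_iff tree_action_mult [OF is_group hom])
qed

text \<open>Modulo the kernel only the exponents \<open>0, \<dots>, m - 1\<close> are needed.\<close>

lemma finite_image_powers:
  assumes c: "u \<in> carrier G" "g \<in> carrier G" "w \<in> carrier G"
    and m: "0 < m" "g [^] (m::nat) \<in> action_kernel G \<psi>"
  shows "finite (to_quotient G \<psi> ` range (\<lambda>n::int. u \<otimes> g [^] n \<otimes> w))"
proof (rule finite_subset)
  let ?A = "action_kernel G \<psi>"
  interpret K: normal ?A G by (rule normal_action_kernel [OF is_group hom])
  have "to_quotient G \<psi> (u \<otimes> g [^] n \<otimes> w) = to_quotient G \<psi> (u \<otimes> g [^] (n mod int m) \<otimes> w)" for n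
  proof -
    have "g [^] n = (g [^] m) [^] (n div int m) \<otimes> g [^] (n mod int m)"
      using c(2) by (simp add: int_pow_int [symmetric] int_pow_pow int_pow_mult [symmetric])
    moreover have "(g [^] m) [^] (n div int m) \<in> ?A"
      using m(2) K.subgroup_axioms subgroup_int_pow_closed by blast
    ultimately show ?thesis
      using same_coset_kernel_mult [of u _ "g [^] (n mod int m)" w] c by (metis int_pow_closed)
  qed
  moreover have "n mod int m \<in> {0..<int m}" for n
    using m(1) by simp
  ultimately show "to_quotient G \<psi> ` range (\<lambda>n::int. u \<otimes> g [^] n \<otimes> w) \<subseteq>
      (\<lambda>n. to_quotient G \<psi> (u \<otimes> g [^] n \<otimes> w)) ` {0..<int m}"
    by blast
qed simp

lemma finite_image_inv:
  assumes "finite (to_quotient G \<psi> ` S)" "S \<subseteq> carrier G"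
  shows "finite (to_quotient G \<psi> ` (\<lambda>g. inv g) ` S)"
proof (rule finite_subset)
  interpret K: normal "action_kernel G \<psi>" G by (rule normal_action_kernel [OF is_group hom])
  have "to_quotient G \<psi> (inv g) = set_inv (to_quotient G \<psi> g)" if "g \<in> S" for g
    using that assms(2) by (simp add: to_quotient_def K.rcos_inv subset_iff)
  then show "to_quotient G \<psi> ` (\<lambda>g. inv g) ` S \<subseteq> (\<lambda>C. set_inv C) ` to_quotient G \<psi> ` S"
    by blast
  show "finite ((\<lambda>C. set_inv C) ` to_quotient G \<psi> ` S)" using assms(1) by simp
qed

text \<open>
  The set \<open>T\<close> is a coinductive certificate: no permutation of a letter can ever be met by following
  restrictions of its elements.
\<close>

lemma subset_action_kernel:
  assumes T: "\<forall>t \<in> T. \<forall>x. snd (\<psi> t) x = x \<and> fst (\<psi> t) x \<in> T" "T \<subseteq> carrier G"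
  shows "T \<subseteq> action_kernel G \<psi>"
proof
  fix t assume t: "t \<in> T"
  then have "tree_action \<psi> t v = v" for v
    using T(1) by (induction v arbitrary: t) auto
  then show "t \<in> action_kernel G \<psi>" using t T(2) by (auto simp: action_kernel_def)
qed

text \<open>Restrictions commute with the projection to the faithful quotient.\<close>

lemma contracting_quotient:
  assumes N: "absorbing G \<psi> N" and fin: "finite (to_quotient G \<psi> ` N)"
  shows "contracting (faithful_quotient G \<psi>) (quotient_recursion G \<psi>)"
proof -
  have rest: "restriction (quotient_recursion G \<psi>) (to_quotient G \<psi> h) v =
      to_quotient G \<psi> (restriction \<psi> h v)" if "h \<in> carrier G" for h v
    using that
    by (induction v arbitrary: h) (auto simp: quotient_recursion_to_quotient [OF is_group hom])
  have carrier: "carrier (faithful_quotient G \<psi>) = to_quotient G \<psi> ` carrier G"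
    by (auto simp: faithful_quotient_def FactGroup_def RCOSETS_def to_quotient_def)
  have "absorbing (faithful_quotient G \<psi>) (quotient_recursion G \<psi>) (to_quotient G \<psi> ` N)"
    unfolding absorbing_def carrier
  proof (intro conjI ballI)
    show "to_quotient G \<psi> ` N \<subseteq> to_quotient G \<psi> ` carrier G"
      using N by (auto simp: absorbing_def)
    fix C assume "C \<in> to_quotient G \<psi> ` carrier G"
    then obtain h where h: "h \<in> carrier G" "C = to_quotient G \<psi> h" by blast
    then obtain n where "\<forall>v. n \<le> length v \<longrightarrow> restriction \<psi> h v \<in> N"
      using N unfolding absorbing_def by blast
    then show "\<exists>n. \<forall>v. n \<le> length v \<longrightarrow>
        restriction (quotient_recursion G \<psi>) C v \<in> to_quotient G \<psi> ` N"
      using rest h by auto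
  qed
  then show ?thesis using fin unfolding contracting_def by blast
qed

text \<open>
  The recursion read off from the biset agrees with \<open>\<psi>\<close> on the carrier, hence is itself a
  self-similar action with the same kernel and the same restrictions.
\<close>

lemma sub_hyperbolic_if_absorbing:
  assumes N: "absorbing G \<psi> N" and fin: "finite (to_quotient G \<psi> ` N)"
  shows "sub_hyperbolic G (action_biset G \<psi>)"
proof -
  define \<phi> where "\<phi> = biset_recursion G (action_biset G \<psi>)"
  have eq: "\<phi> h = \<psi> h" if "h \<in> carrier G" for h
    using that biset_recursion_action_biset [OF is_group hom] by (simp add: \<phi>_def)
  have "\<phi> \<in> hom G (wreath_product G)"
    using hom by (auto simp: hom_def eq Pi_def)
  then interpret biset: self_similar_action G \<phi> by unfold_locales
  have "tree_action \<phi> h v = tree_action \<psi> h v \<and> restriction \<phi> h v = restriction \<psi> h v"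
    if "h \<in> carrier G" for h v
    using that by (induction v arbitrary: h) (auto simp: eq)
  then have same: "absorbing G \<phi> N" "action_kernel G \<phi> = action_kernel G \<psi>"
    using N by (simp_all add: absorbing_def action_kernel_def cong: conj_cong)
  then have "to_quotient G \<phi> ` N = to_quotient G \<psi> ` N"
    by (simp add: to_quotient_def)
  then show ?thesis
    using fin biset.contracting_quotient [OF same(1)]
    unfolding sub_hyperbolic_def \<phi>_def [symmetric] by simp
qed

lemma nucleus_finite_in_quotient:
  assumes "\<And>h. h \<in> carrier G \<Longrightarrow> finite (range (restriction \<psi> h))"
    and M: "absorbing G \<psi> M" "finite (to_quotient G \<psi> ` M)"
  shows "is_nucleus G \<psi> (recurrent G \<psi>)"
    and "recurrent G \<psi> \<subseteq> M"
    and "finite (to_quotient G \<psi> ` recurrent G \<psi>)"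
    and "sub_hyperbolic G (action_biset G \<psi>)"
  using is_nucleus_recurrent [OF assms(1)] recurrent_subset_absorbing [OF M(1)]
    finite_subset [OF image_mono [OF recurrent_subset_absorbing [OF M(1)]] M(2)]
    sub_hyperbolic_if_absorbing [OF M]
  by auto

end

section \<open>Recursions of the free group\<close>

interpretation F2: group F2
  by (rule group_free_group)

lemma carrier_F2 [simp]: "w \<in> carrier F2 \<longleftrightarrow> reduced w"
  by (simp add: free_group_def)

lemma F2_mult: "u \<cdot> v = foldr push u v"
  by (simp add: free_group_def)

lemma F2_one: "\<epsilon> = []"
  by (simp add: free_group_def)

definition word_inv :: "gen word \<Rightarrow> gen word" where
  "word_inv w = rev (map inv_letter w)"

lemma F2_inv:
  assumes "reduced w" shows "inv\<^bsub>F2\<^esub> w = word_inv w"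
proof (rule F2.inv_equality)
  show "word_inv w \<cdot> w = \<epsilon>"
    using foldr_push_inverse [of "[]" w] foldr_push_reduced [OF assms]
    by (simp add: F2_mult F2_one word_inv_def reduced_def)
qed (use assms in \<open>simp_all add: word_inv_def reduced_inverse\<close>)

lemma reduced_generators [simp]: "reduced \<alpha>" "reduced \<beta>" "reduced \<gamma>" "reduced \<delta>" "reduced [l]" "reduced []"
proof -
  show ab: "reduced \<alpha>" "reduced \<beta>" "reduced [l]" "reduced []"
    by (simp_all add: \<alpha>_def \<beta>_def reduced_def)
  then have "\<gamma> \<in> carrier F2" "\<delta> \<in> carrier F2"
    unfolding \<gamma>_def \<delta>_def by (metis F2.inv_closed F2.m_closed carrier_F2)+
  then show "reduced \<gamma>" "reduced \<delta>" by simp_all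
qed

lemma reduced_F2_ops [simp]:
  "reduced u \<Longrightarrow> reduced v \<Longrightarrow> reduced (u \<cdot> v)"
  "reduced u \<Longrightarrow> reduced (inv\<^bsub>F2\<^esub> u)"
  "reduced u \<Longrightarrow> reduced (u \<up> n)"
  "reduced \<epsilon>"
  using F2.m_closed F2.inv_closed F2.int_pow_closed F2.one_closed unfolding carrier_F2 by blast+

lemma letter_mult:
  assumes "reduced (l # w)" shows "[l] \<cdot> w = l # w"
  using assms by (cases w) (auto simp: F2_mult reduced_def)

lemma letter_F2_cases:
  obtains "[l] = \<alpha>" | "[l] = \<alpha>'" | "[l] = \<beta>" | "[l] = \<beta>'"
proof -
  have "\<alpha>' = [(Gen_alpha, False)]" "\<beta>' = [(Gen_beta, False)]"
    by (simp_all add: F2_inv) (simp_all add: \<alpha>_def \<beta>_def word_inv_def inv_letter_def)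
  then show ?thesis
    using that unfolding \<alpha>_def \<beta>_def by (metis (full_types) gen.exhaust surj_pair)
qed

lemma reduced_induct [consumes 1, case_names Nil Cons]:
  assumes "reduced w" "P \<epsilon>" "\<And>l w. reduced w \<Longrightarrow> P w \<Longrightarrow> P ([l] \<cdot> w)"
  shows "P (w :: gen word)"
  using assms(1)
proof (induction w)
  case (Cons l w)
  have "reduced w" using Cons.prems by (cases w) (auto simp: reduced_def)
  then show ?case using Cons.IH assms(3) [of w l] letter_mult [OF Cons.prems] by simp
qed (use assms(2) in \<open>simp add: F2_one\<close>)

lemma \<sigma>_simps [simp]: "\<sigma> L1 = L2" "\<sigma> L2 = L1" "\<sigma> (\<sigma> x) = x"
  by (simp_all add: \<sigma>_def)

text \<open>
  All fourteen recursions have the form \<open>\<alpha> = \<langle>1, a\<rangle>\<sigma>\<close>, \<open>\<beta> = \<langle>b, c\<rangle>\<close>.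
\<close>

locale f2_recursion =
  fixes \<psi> :: "gen word \<Rightarrow> gen word wreath" and a b c :: "gen word"
  assumes \<psi>_hom: "\<psi> \<in> hom F2 (wreath_product F2)"
    and \<psi>_\<alpha>: "\<psi> \<alpha> = wr \<epsilon> a \<sigma>"
    and \<psi>_\<beta>: "\<psi> \<beta> = wr b c id"
begin

sublocale self_similar_action F2 \<psi>
  by unfold_locales (rule \<psi>_hom)

lemma reduced_parameters [simp]: "reduced a" "reduced b" "reduced c"
  using section_closed [of \<alpha> L2] section_closed [of \<beta> L1] section_closed [of \<beta> L2]
  by (simp_all add: \<psi>_\<alpha> \<psi>_\<beta> wr_def)

lemma reduced_section [simp]: "reduced w \<Longrightarrow> reduced (fst (\<psi> w) x)"
  using section_closed [of w x] by simp

lemma reduced_restriction [simp]: "reduced w \<Longrightarrow> reduced (restriction \<psi> w v)"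
  using restriction_closed [of w v] by simp

lemma snd_\<psi>_\<alpha> [simp]: "snd (\<psi> \<alpha>) x = \<sigma> x" "snd (\<psi> \<alpha>') x = \<sigma> x"
  and fst_\<psi>_\<alpha> [simp]: "fst (\<psi> \<alpha>) L1 = \<epsilon>" "fst (\<psi> \<alpha>) L2 = a"
    "fst (\<psi> \<alpha>') L1 = inv\<^bsub>F2\<^esub> a" "fst (\<psi> \<alpha>') L2 = \<epsilon>"
  using section_inv [of \<alpha> "\<sigma> x"] section_inv [of \<alpha> L1] section_inv [of \<alpha> L2]
  by (simp_all add: \<psi>_\<alpha> wr_def)

lemma snd_\<psi>_\<beta> [simp]: "snd (\<psi> \<beta>) x = x" "snd (\<psi> \<beta>') x = x" "snd (\<psi> (\<beta> \<up> n)) x = x"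
  and fst_\<psi>_\<beta> [simp]: "fst (\<psi> \<beta>) L1 = b" "fst (\<psi> \<beta>) L2 = c"
    "fst (\<psi> \<beta>') L1 = inv\<^bsub>F2\<^esub> b" "fst (\<psi> \<beta>') L2 = inv\<^bsub>F2\<^esub> c"
    "fst (\<psi> (\<beta> \<up> n)) L1 = b \<up> n" "fst (\<psi> (\<beta> \<up> n)) L2 = c \<up> n"
  using section_inv [of \<beta> x] section_inv [of \<beta> L1] section_inv [of \<beta> L2]
    section_pow_fixed [of \<beta> x n] section_pow_fixed [of \<beta> L1 n] section_pow_fixed [of \<beta> L2 n]
  by (simp_all add: \<psi>_\<beta> wr_def)

lemma finite_states:
  assumes S: "finite S" "\<And>l. [l] \<in> S" "\<And>s x. s \<in> S \<Longrightarrow> fst (\<psi> s) x \<in> S"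
    and w: "w \<in> carrier F2"
  shows "finite (range (restriction \<psi> w))"
proof -
  have "restriction \<psi> s v \<in> S" if "s \<in> S" for s v
    using that by (induction v arbitrary: s) (auto simp: S)
  then have letter: "finite (range (restriction \<psi> [l]))" for l
    by (meson S(1,2) finite_subset image_subsetI)
  have "reduced w" using w by simp
  then show ?thesis
    by (induction w rule: reduced_induct) (auto intro!: finite_states_mult letter)
qed

text \<open>
  Induction on the length of a word \<open>l # w\<close>.  At depth \<open>n\<close> the restrictions of \<open>w\<close> have arrived in
  \<open>M\<close> while those of \<open>l\<close> are in \<open>S\<close>, so a restriction of the whole word is a product
  \<open>s \<cdot> g\<close>, which needs \<open>k\<close> further levels.
\<close>

lemma absorbing_if_products:
  assumes S: "\<And>l. [l] \<in> S" "\<And>s x. s \<in> S \<Longrightarrow> fst (\<psi> s) x \<in> S" "S \<subseteq> carrier F2"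
    and M: "\<epsilon> \<in> M" "M \<subseteq> carrier F2"
    and prod: "\<And>s g v. s \<in> S \<Longrightarrow> g \<in> M \<Longrightarrow> k \<le> length v \<Longrightarrow> restriction \<psi> (s \<cdot> g) v \<in> M"
  shows "absorbing F2 \<psi> M"
  unfolding absorbing_def
proof (intro conjI ballI)
  have S': "restriction \<psi> s v \<in> S" if "s \<in> S" for s v
    using that by (induction v arbitrary: s) (auto simp: S)
  fix w assume "w \<in> carrier F2"
  then have "reduced w" by simp
  then show "\<exists>n. \<forall>v. n \<le> length v \<longrightarrow> restriction \<psi> w v \<in> M"
  proof (induction w rule: reduced_induct)
    case Nil
    then show ?case using M(1) by simp
  next
    case (Cons l w)
    then obtain n where n: "\<And>v. n \<le> length v \<Longrightarrow> restriction \<psi> w v \<in> M" by blast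
    have "restriction \<psi> ([l] \<cdot> w) v \<in> M" if v: "n + k \<le> length v" for v
    proof -
      have "restriction \<psi> ([l] \<cdot> w) v = restriction \<psi> (restriction \<psi> ([l] \<cdot> w) (take n v)) (drop n v)"
        by (simp flip: restriction_append)
      also have "restriction \<psi> ([l] \<cdot> w) (take n v) =
          restriction \<psi> [l] (take n v) \<cdot> restriction \<psi> w (tree_action \<psi> [l] (take n v))"
        using Cons.hyps by (simp add: restriction_mult)
      finally show ?thesis using prod S' [OF S(1)] n v by simp
    qed
    then show ?case by blast
  qed
qed (fact M(2))

end


text \<open>
  The assertion of the theorem about one recursion.  An absorbing set inside the listed one
  bounds the nucleus from above; recurrence of the listed elements bounds it from below.
\<close>

definition nucleus_claim :: "nat \<Rightarrow> bool" where
  "nucleus_claim i \<longleftrightarrow>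
     (\<exists>N. is_nucleus F2 (recursion i) N \<and>
          finite (to_quotient F2 (recursion i) ` N) \<and>
          (i \<notin> {2, 5, 6} \<longrightarrow> N \<subseteq> listed_nucleus i) \<and>
          (i \<notin> {2, 9, 11, 14} \<longrightarrow> listed_nucleus i \<subseteq> N)) \<and>
     finite (to_quotient F2 (recursion i) ` listed_nucleus i) \<and>
     sub_hyperbolic F2 (action_biset F2 (recursion i))"

lemma f2_recursion_recursion:
  assumes "i \<in> {1..14}" "gen_images i = (wr \<epsilon> a \<sigma>, wr b c id)"
  shows "f2_recursion (recursion i) a b c"
  using recursion_hom [OF assms(1)] assms(2) by unfold_locales simp_all

lemma (in f2_recursion) nucleus_claimI:
  assumes "\<psi> = recursion i"
    and "\<And>w. w \<in> carrier F2 \<Longrightarrow> finite (range (restriction \<psi> w))"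
    and "absorbing F2 \<psi> M" "finite (to_quotient F2 \<psi> ` M)"
    and "finite (to_quotient F2 \<psi> ` listed_nucleus i)"
    and "i \<notin> {2, 5, 6} \<Longrightarrow> M \<subseteq> listed_nucleus i"
    and "i \<notin> {2, 9, 11, 14} \<Longrightarrow> listed_nucleus i \<subseteq> recurrent F2 \<psi>"
  shows "nucleus_claim i"
  unfolding nucleus_claim_def
  using nucleus_finite_in_quotient [OF assms(2-4)] assms(5-7) unfolding assms(1)
  by blast

section \<open>Finite nuclei by computation with words\<close>

fun letter_section :: "gen word \<Rightarrow> gen word \<Rightarrow> gen word \<Rightarrow> gen \<times> bool \<Rightarrow> letter \<Rightarrow> gen word" where
  "letter_section a b c (Gen_alpha, True) L1 = []"
| "letter_section a b c (Gen_alpha, True) L2 = a"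
| "letter_section a b c (Gen_alpha, False) L1 = word_inv a"
| "letter_section a b c (Gen_alpha, False) L2 = []"
| "letter_section a b c (Gen_beta, True) L1 = b"
| "letter_section a b c (Gen_beta, True) L2 = c"
| "letter_section a b c (Gen_beta, False) L1 = word_inv b"
| "letter_section a b c (Gen_beta, False) L2 = word_inv c"

fun letter_perm :: "gen \<times> bool \<Rightarrow> letter \<Rightarrow> letter" where
  "letter_perm (Gen_alpha, s) L1 = L2"
| "letter_perm (Gen_alpha, s) L2 = L1"
| "letter_perm (Gen_beta, s) x = x"

text \<open>
  Restrictions at a single letter, called sections below, are computed on the letters of the word
  and multiplied out, so that the simplifier can evaluate them on concrete words.
\<close>

fun word_section :: "gen word \<Rightarrow> gen word \<Rightarrow> gen word \<Rightarrow> gen word \<Rightarrow> letter \<Rightarrow> gen word" where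
  "word_section a b c [] x = []"
| "word_section a b c (l # w) x =
     foldr push (letter_section a b c l x) (word_section a b c w (letter_perm l x))"

text \<open>
  All restrictions of \<open>w\<close> at depth \<open>k\<close> lie in the section-closed list \<open>M\<close>.  Branches are left as
  soon as they enter \<open>M\<close>, and the nested conditionals keep the simplifier from
  evaluating the rest.
\<close>

fun sections_reach :: "gen word \<Rightarrow> gen word \<Rightarrow> gen word \<Rightarrow> gen word list \<Rightarrow> nat \<Rightarrow> gen word \<Rightarrow> bool" where
  "sections_reach a b c M 0 w = List.member M w"
| "sections_reach a b c M (Suc k) w =
     (if List.member M w then True
      else if sections_reach a b c M k (word_section a b c w L1)
      then sections_reach a b c M k (word_section a b c w L2) else False)"

definition section_closed_list :: "gen word \<Rightarrow> gen word \<Rightarrow> gen word \<Rightarrow> gen word list \<Rightarrow> bool" where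
  "section_closed_list a b c M \<longleftrightarrow> list_all (\<lambda>w. reduced w \<and>
     List.member M (word_section a b c w L1) \<and> List.member M (word_section a b c w L2)) M"

text \<open>The hypotheses of \<open>absorbing_if_products\<close> for lists of words, in executable form.\<close>

definition absorbing_certificate ::
    "gen word \<Rightarrow> gen word \<Rightarrow> gen word \<Rightarrow> nat \<Rightarrow> gen word list \<Rightarrow> gen word list \<Rightarrow> bool" where
  "absorbing_certificate a b c k S M \<longleftrightarrow>
     section_closed_list a b c S \<and> section_closed_list a b c M \<and> List.member M [] \<and>
     list_all (List.member S)
       [[(Gen_alpha, True)], [(Gen_alpha, False)], [(Gen_beta, True)], [(Gen_beta, False)]] \<and>
     list_all (\<lambda>s. list_all (\<lambda>g. sections_reach a b c M k (foldr push s g)) M) S"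

text \<open>The hypotheses of \<open>recurrent_if_predecessors\<close> in executable form.\<close>

definition recurrence_certificate ::
    "gen word \<Rightarrow> gen word \<Rightarrow> gen word \<Rightarrow> gen word list \<Rightarrow> bool" where
  "recurrence_certificate a b c R \<longleftrightarrow> list_all (\<lambda>g. reduced g \<and>
     list_ex (\<lambda>h. word_section a b c h L1 = g \<or> word_section a b c h L2 = g) R) R"


context f2_recursion
begin

lemma section_letter:
  "fst (\<psi> [l]) x = letter_section a b c l x \<and> snd (\<psi> [l]) x = letter_perm l x"
proof -
  have inv: "\<alpha>' = [(Gen_alpha, False)]" "\<beta>' = [(Gen_beta, False)]"
    by (simp_all add: F2_inv) (simp_all add: \<alpha>_def \<beta>_def word_inv_def inv_letter_def)
  obtain g s where l: "l = (g, s)" by fastforce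
  show ?thesis
    by (cases g; cases s; cases x)
       (simp_all add: l inv [symmetric] \<alpha>_def [symmetric] \<beta>_def [symmetric] F2_one F2_inv [of a]
         F2_inv [of b] F2_inv [of c])
qed

lemma section_word: "reduced w \<Longrightarrow> fst (\<psi> w) x = word_section a b c w x"
proof (induction w arbitrary: x)
  case Nil
  then show ?case using section_one(2) [of x] by (simp add: F2_one)
next
  case (Cons l w)
  have w: "reduced w" using Cons.prems by (cases w) (auto simp: reduced_def)
  have "fst (\<psi> (l # w)) x = fst (\<psi> ([l] \<cdot> w)) x"
    using letter_mult [OF Cons.prems] by simp
  also have "\<dots> = letter_section a b c l x \<cdot> word_section a b c w (letter_perm l x)"
    using w by (simp add: section_mult section_letter Cons.IH)
  finally show ?case by (simp add: F2_mult)
qed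

lemma section_closed_listD:
  assumes "section_closed_list a b c M"
  shows "set M \<subseteq> carrier F2" "g \<in> set M \<Longrightarrow> fst (\<psi> g) x \<in> set M"
    "g \<in> set M \<Longrightarrow> restriction \<psi> g v \<in> set M"
proof -
  show M: "set M \<subseteq> carrier F2"
    using assms by (auto simp: section_closed_list_def list_all_iff)
  show sec: "fst (\<psi> g) x \<in> set M" if "g \<in> set M" for g x
    using that assms M by (cases x) (auto simp: section_closed_list_def list_all_iff section_word)
  show "restriction \<psi> g v \<in> set M" if "g \<in> set M"
    using that by (induction v arbitrary: g) (auto simp: sec)
qed

lemma sections_reachD:
  assumes "section_closed_list a b c M" "sections_reach a b c M k w" "reduced w" "k \<le> length v"
  shows "restriction \<psi> w v \<in> set M"
  using assms(2-)
proof (induction k arbitrary: w v)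
  case 0
  then show ?case using section_closed_listD(3) [OF assms(1)] by simp
next
  case (Suc k)
  show ?case
  proof (cases "w \<in> set M")
    case True
    then show ?thesis using section_closed_listD(3) [OF assms(1)] by simp
  next
    case False
    obtain x u where v: "v = x # u" using Suc.prems by (cases v) auto
    have "sections_reach a b c M k (fst (\<psi> w) x)"
      using Suc.prems False by (cases x) (auto simp: section_word split: if_splits)
    then show ?thesis using Suc.IH Suc.prems v by simp
  qed
qed

lemma absorbing_certificateD:
  assumes "absorbing_certificate a b c k S M"
  shows "absorbing F2 \<psi> (set M)"
    and "w \<in> carrier F2 \<Longrightarrow> finite (range (restriction \<psi> w))"
proof -
  have S: "section_closed_list a b c S" and M: "section_closed_list a b c M" and "\<epsilon> \<in> set M"
    and prod: "\<And>s g. s \<in> set S \<Longrightarrow> g \<in> set M \<Longrightarrow> sections_reach a b c M k (s \<cdot> g)"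
    using assms by (simp_all add: absorbing_certificate_def list_all_iff F2_one F2_mult)
  have letters: "[l] \<in> set S" for l
  proof -
    obtain g s where "l = (g, s)" by fastforce
    then show ?thesis
      using assms by (cases g; cases s) (auto simp: absorbing_certificate_def)
  qed
  note S' = section_closed_listD [OF S] and M' = section_closed_listD [OF M]
  show "absorbing F2 \<psi> (set M)"
  proof (rule absorbing_if_products [OF letters S'(2) S'(1) \<open>\<epsilon> \<in> set M\<close> M'(1)])
    fix s g and v :: "letter list"
    assume *: "s \<in> set S" "g \<in> set M" "k \<le> length v"
    then have "s \<in> carrier F2" "g \<in> carrier F2"
      using S'(1) M'(1) by blast+
    then have "reduced (s \<cdot> g)" by simp
    with * show "restriction \<psi> (s \<cdot> g) v \<in> set M"
      using sections_reachD [OF M prod] by blast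
  qed
  show "finite (range (restriction \<psi> w))" if "w \<in> carrier F2"
    using finite_states [of "set S"] letters S'(2) that by blast
qed

lemma recurrence_certificateD:
  assumes "recurrence_certificate a b c R"
  shows "set R \<subseteq> recurrent F2 \<psi>"
proof (rule recurrent_if_predecessors)
  show R: "set R \<subseteq> carrier F2"
    using assms by (auto simp: recurrence_certificate_def list_all_iff)
  fix g assume "g \<in> set R"
  then obtain h where h: "h \<in> set R" "word_section a b c h L1 = g \<or> word_section a b c h L2 = g"
    using assms unfolding recurrence_certificate_def list_all_iff list_ex_iff by blast
  moreover have "reduced h" using h(1) R by auto
  ultimately show "\<exists>h \<in> set R. \<exists>x. fst (\<psi> h) x = g" using section_word by metis
qed simp

end

lemma nucleus_claim_finite:
  assumes M: "absorbing_certificate a b c k S M"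
    and R: "recurrence_certificate a b c R"
    and i: "i \<in> {1..14}" "gen_images i = (wr \<epsilon> a \<sigma>, wr b c id)"
    and listed: "i \<notin> {2, 5, 6} \<Longrightarrow> set M \<subseteq> listed_nucleus i"
      "i \<notin> {2, 9, 11, 14} \<Longrightarrow> listed_nucleus i \<subseteq> set R"
      "finite (listed_nucleus i)"
  shows "nucleus_claim i"
proof -
  interpret f2_recursion "recursion i" a b c by (rule f2_recursion_recursion [OF i])
  show ?thesis
    using absorbing_certificateD [OF M] recurrence_certificateD [OF R] listed
    by (intro nucleus_claimI [of i "set M"]) auto
qed

lemma F2_pow_minus2: "reduced g \<Longrightarrow> g \<up> (- 2) = inv\<^bsub>F2\<^esub> (g \<cdot> g)"
  and F2_pow_2: "reduced g \<Longrightarrow> g \<up> 2 = g \<cdot> g"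
  by (simp_all add: int_pow_def2 numeral_2_eq_2)

lemmas word_simps = F2_one F2_mult F2_inv F2_pow_2 F2_pow_minus2 \<alpha>_def \<beta>_def \<gamma>_def \<delta>_def
  reduced_def word_inv_def inv_letter_def

abbreviation "al \<equiv> (Gen_alpha, True)"
abbreviation "al' \<equiv> (Gen_alpha, False)"
abbreviation "be \<equiv> (Gen_beta, True)"
abbreviation "be' \<equiv> (Gen_beta, False)"

text \<open>
  In each of the following proofs \<open>?M\<close> is the absorbing set, \<open>?S\<close> the set of restrictions of the
  generators and their inverses, and \<open>?R\<close> a set of recurrent elements; coinciding sets share
  a name.  The number in the certificate is the depth at which products have returned to \<open>?M\<close>.
\<close>

lemma nucleus_claim_2: "nucleus_claim 2"
proof -
  let ?M = "[[], [al'], [be'], [al], [be], [al', be'], [be, al], [al', al', be'], [be, al', be'],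
      [be, al, be'], [be, al, al], [al', al', al', be'], [al', be', al', be'],
      [be, al', al', be'], [be, al, al, be'], [be, al, al, al], [be, al, be, al],
      [al', be', al', al', be'], [be, al, be', al', be'], [be, al, al, be, al],
      [be, al, be, al', be'], [be, al, be', al', al', be'], [be, al, al, be, al', be']]"
  let ?S = "[[], [al'], [be'], [al], [be], [al', be'], [be, al], [al', al', be'], [be, al', be'],
      [be, al, be'], [be, al, al]]"
  \<comment> \<open>Listed set and nucleus are incomparable here, so the recurrence set is just the identity.\<close>
  have "absorbing_certificate [] [al', be'] [be, al, be'] 3 ?S ?M"
    by code_simp
  moreover have "recurrence_certificate [] [al', be'] [be, al, be'] [[]]"
    by code_simp
  ultimately show ?thesis
    by (rule nucleus_claim_finite)
      (simp_all add: gen_images_def listed_nucleus_def pm_def word_simps)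
qed

lemma nucleus_claim_3: "nucleus_claim 3"
proof -
  let ?M = "[[], [al'], [al], [be', al'], [al, be]]"
  let ?S = "[[], [al'], [be'], [al], [be], [be', al'], [al, be]]"
  have "absorbing_certificate [] [al] [be', al'] 3 ?S ?M"
    by code_simp
  moreover have "recurrence_certificate [] [al] [be', al'] ?M"
    by code_simp
  ultimately show ?thesis
    by (rule nucleus_claim_finite)
      (simp_all add: gen_images_def listed_nucleus_def pm_def word_simps)
qed

lemma nucleus_claim_4: "nucleus_claim 4"
proof -
  let ?M = "[[], [al'], [al], [al', be'], [be, al]]"
  let ?S = "[[], [al'], [be'], [al], [be], [al', be'], [be, al]]"
  have "absorbing_certificate [] [al] [al', be'] 3 ?S ?M"
    by code_simp
  moreover have "recurrence_certificate [] [al] [al', be'] ?M"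
    by code_simp
  ultimately show ?thesis
    by (rule nucleus_claim_finite)
      (simp_all add: gen_images_def listed_nucleus_def pm_def word_simps)
qed

lemma nucleus_claim_8: "nucleus_claim 8"
proof -
  let ?M = "[[], [al'], [be'], [al], [be], [al, be'], [be, al']]"
  let ?S = "[[], [al'], [be'], [al], [be]]"
  have "absorbing_certificate [be] [al] [] 2 ?S ?M"
    by code_simp
  moreover have "recurrence_certificate [be] [al] [] ?M"
    by code_simp
  ultimately show ?thesis
    by (rule nucleus_claim_finite)
      (simp_all add: gen_images_def listed_nucleus_def pm_def word_simps)
qed

lemma nucleus_claim_9: "nucleus_claim 9"
proof -
  let ?M = "[[], [al'], [be'], [al], [be], [al', be'], [be, al], [be, al', be'], [be, al, be']]"
  let ?R = "[[], [al', be'], [be, al], [be, al', be'], [be, al, be']]"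
  have "absorbing_certificate [be] [] [be, al, be'] 4 ?M ?M"
    by code_simp
  moreover have "recurrence_certificate [be] [] [be, al, be'] ?R"
    by code_simp
  ultimately show ?thesis
    by (rule nucleus_claim_finite)
      (simp_all add: gen_images_def listed_nucleus_def pm_def word_simps)
qed

lemma nucleus_claim_12: "nucleus_claim 12"
proof -
  let ?M = "[[], [al'], [be'], [al], [be], [al', be'], [be, al]]"
  have "absorbing_certificate [al', be'] [] [al] 2 ?M ?M"
    by code_simp
  moreover have "recurrence_certificate [al', be'] [] [al] ?M"
    by code_simp
  ultimately show ?thesis
    by (rule nucleus_claim_finite)
      (simp_all add: gen_images_def listed_nucleus_def pm_def word_simps)
qed

lemma nucleus_claim_13: "nucleus_claim 13"
proof -
  let ?M = "[[], [al'], [be'], [al], [be], [be', al'], [al, be]]"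
  have "absorbing_certificate [be', al'] [al] [] 2 ?M ?M"
    by code_simp
  moreover have "recurrence_certificate [be', al'] [al] [] ?M"
    by code_simp
  ultimately show ?thesis
    by (rule nucleus_claim_finite)
      (simp_all add: gen_images_def listed_nucleus_def pm_def word_simps)
qed

lemma nucleus_claim_14: "nucleus_claim 14"
proof -
  let ?M = "[[], [al'], [be'], [al], [be], [al', be'], [be, al]]"
  let ?R = "[[], [al'], [al], [al', be'], [be, al]]"
  have "absorbing_certificate [al', be'] [al] [] 3 ?M ?M"
    by code_simp
  moreover have "recurrence_certificate [al', be'] [al] [] ?R"
    by code_simp
  ultimately show ?thesis
    by (rule nucleus_claim_finite)
      (simp_all add: gen_images_def listed_nucleus_def pm_def word_simps)
qed

section \<open>Nuclei made of powers\<close>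

text \<open>
  Words with a parameter in the exponent are normalised by rewriting.  Powers of \<open>\<beta>\<close> get a name
  of their own, so that \<open>\<beta>\<close> itself can be rewritten to a power without looping and
  adjacent powers always merge.
\<close>

definition beta_pow :: "int \<Rightarrow> gen word" where
  "beta_pow n = \<beta> \<up> n"

lemma reduced_beta_pow [simp]: "reduced (beta_pow n)"
  by (simp add: beta_pow_def)

lemma beta_pow_0 [simp]: "beta_pow 0 = \<epsilon>"
  and \<beta>_beta_pow: "\<beta> = beta_pow 1"
  and beta_pow_mult: "beta_pow m \<cdot> beta_pow n = beta_pow (m + n)"
  and inv_beta_pow: "inv\<^bsub>F2\<^esub> (beta_pow n) = beta_pow (- n)"
  by (simp_all add: beta_pow_def F2.int_pow_mult F2.int_pow_neg F2.int_pow_1)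

lemma beta_pow_mult_left: "reduced w \<Longrightarrow> beta_pow m \<cdot> (beta_pow n \<cdot> w) = beta_pow (m + n) \<cdot> w"
  by (simp flip: F2.m_assoc add: beta_pow_mult)

lemma beta_pow_pow [simp]: "beta_pow m \<up> n = beta_pow (m * n)"
  by (simp add: beta_pow_def F2.int_pow_pow)

lemma F2_cancel:
  "reduced g \<Longrightarrow> reduced w \<Longrightarrow> g \<cdot> (inv\<^bsub>F2\<^esub> g \<cdot> w) = w"
  "reduced g \<Longrightarrow> reduced w \<Longrightarrow> inv\<^bsub>F2\<^esub> g \<cdot> (g \<cdot> w) = w"
  by (simp_all flip: F2.m_assoc)

lemma conj_pow:
  assumes "reduced g" "reduced h"
  shows "(inv\<^bsub>F2\<^esub> h \<cdot> (g \<cdot> h)) \<up> (n::int) = inv\<^bsub>F2\<^esub> h \<cdot> (g \<up> n \<cdot> h)"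
proof -
  have nat: "(inv\<^bsub>F2\<^esub> h \<cdot> (g \<cdot> h)) [^]\<^bsub>F2\<^esub> k = inv\<^bsub>F2\<^esub> h \<cdot> (g [^]\<^bsub>F2\<^esub> k \<cdot> h)" for k :: nat
  proof (induction k)
    case (Suc k)
    have "reduced (g [^]\<^bsub>F2\<^esub> k)" using assms F2.nat_pow_closed [of g k] by simp
    then show ?case using Suc assms by (simp add: F2.m_assoc F2_cancel)
  qed (use assms in simp)
  have red: "reduced (g [^]\<^bsub>F2\<^esub> k)" for k :: nat
    using assms F2.nat_pow_closed [of g k] by simp
  show ?thesis
  proof (cases "n < 0")
    case True
    have "inv\<^bsub>F2\<^esub> (inv\<^bsub>F2\<^esub> h \<cdot> (g [^]\<^bsub>F2\<^esub> nat (- n) \<cdot> h)) =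
        inv\<^bsub>F2\<^esub> h \<cdot> (inv\<^bsub>F2\<^esub> (g [^]\<^bsub>F2\<^esub> nat (- n)) \<cdot> h)"
      using assms red by (simp add: F2.inv_mult_group F2.m_assoc)
    then show ?thesis using True unfolding int_pow_def2 by (simp only: nat if_True)
  next
    case False
    then show ?thesis unfolding int_pow_def2 by (simp only: nat if_False)
  qed
qed

lemmas F2_normalise = F2.m_assoc F2_cancel F2.inv_mult_group beta_pow_mult beta_pow_mult_left inv_beta_pow

lemma all_letter: "(\<forall>x. P x) \<longleftrightarrow> P L1 \<and> P L2"
  by (metis letter.exhaust)

text \<open>
  All restrictions at depth \<open>k\<close> lie in \<open>M\<close>.  The recursive form lets the simplifier unfold the
  condition for a fixed \<open>k\<close>.
\<close>

fun sections_in :: "('g \<Rightarrow> 'g wreath) \<Rightarrow> 'g set \<Rightarrow> nat \<Rightarrow> 'g \<Rightarrow> bool" where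
  "sections_in \<psi> M 0 g \<longleftrightarrow> g \<in> M"
| "sections_in \<psi> M (Suc k) g \<longleftrightarrow> (\<forall>x. sections_in \<psi> M k (fst (\<psi> g) x))"

lemma restriction_in:
  assumes M: "\<forall>g \<in> M. sections_in \<psi> M 1 g" and "sections_in \<psi> M k g" "k \<le> length v"
  shows "restriction \<psi> g v \<in> M"
  using assms(2,3)
proof (induction v arbitrary: g k)
  case (Cons x v)
  show ?case
  proof (cases k)
    case 0
    then show ?thesis using Cons M by (auto intro: Cons.IH [of 0])
  next
    case (Suc m)
    then show ?thesis using Cons.prems by (auto intro: Cons.IH [of m])
  qed
qed auto

context f2_recursion
begin

lemma snd_\<psi>_beta_pow [simp]: "snd (\<psi> (beta_pow n)) x = x"
  and fst_\<psi>_beta_pow [simp]: "fst (\<psi> (beta_pow n)) L1 = b \<up> n" "fst (\<psi> (beta_pow n)) L2 = c \<up> n"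
  by (simp_all add: beta_pow_def)

lemma absorbing_if_products_in:
  assumes S: "finite S" "\<alpha> \<in> S" "\<alpha>' \<in> S" "beta_pow 1 \<in> S" "beta_pow (-1) \<in> S"
      "\<forall>s \<in> S. \<forall>x. fst (\<psi> s) x \<in> S" "\<forall>s \<in> S. reduced s"
    and M: "\<epsilon> \<in> M" "\<forall>g \<in> M. reduced g" "\<forall>g \<in> M. sections_in \<psi> M 1 g"
    and prod: "\<forall>s \<in> S. \<forall>g \<in> M. sections_in \<psi> M k (s \<cdot> g)"
  shows "absorbing F2 \<psi> M" and "w \<in> carrier F2 \<Longrightarrow> finite (range (restriction \<psi> w))"
proof -
  have letters: "[l] \<in> S" for l
    using S(2-5) by (cases l rule: letter_F2_cases) (auto simp: \<beta>_beta_pow inv_beta_pow)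
  show "absorbing F2 \<psi> M"
  proof (rule absorbing_if_products [of S M k])
    fix s g and v :: "letter list"
    assume "s \<in> S" "g \<in> M" "k \<le> length v"
    then show "restriction \<psi> (s \<cdot> g) v \<in> M"
      using restriction_in [OF M(3), of k "s \<cdot> g" v] prod by blast
  qed (use letters S M in auto)
  show "finite (range (restriction \<psi> w))" if "w \<in> carrier F2"
    by (rule finite_states [of S]) (use letters S that in auto)
qed

end

lemma pm_iff: "S \<subseteq> carrier F2 \<Longrightarrow> reduced g \<Longrightarrow> g \<in> pm S \<longleftrightarrow> g \<in> S \<or> inv\<^bsub>F2\<^esub> g \<in> S"
  by (auto simp: pm_def image_iff) (metis F2.inv_inv carrier_F2)

lemma UN_insert_family: "(\<Union>n. insert (f n) (A n)) = range f \<union> (\<Union>n. A n)"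
  by auto

context f2_recursion
begin

lemma finite_image_pm:
  assumes "finite (to_quotient F2 \<psi> ` S)" "S \<subseteq> carrier F2"
  shows "finite (to_quotient F2 \<psi> ` pm S)"
  using finite_image_inv [OF assms] assms(1) by (simp add: pm_def image_Un)

lemma pm_recurrent: "S \<subseteq> recurrent F2 \<psi> \<Longrightarrow> pm S \<subseteq> recurrent F2 \<psi>"
  by (auto simp: pm_def intro: recurrent_inv)

lemma finite_image_family:
  assumes g: "g [^]\<^bsub>F2\<^esub> (m::nat) \<in> action_kernel F2 \<psi>" "0 < m" "reduced g"
  shows "finite (to_quotient F2 \<psi> ` range (\<lambda>n. g \<up> n))"
    "\<And>u. reduced u \<Longrightarrow> finite (to_quotient F2 \<psi> ` range (\<lambda>n. u \<cdot> g \<up> n))"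
    "\<And>w. reduced w \<Longrightarrow> finite (to_quotient F2 \<psi> ` range (\<lambda>n. g \<up> n \<cdot> w))"
    "\<And>u w. reduced u \<Longrightarrow> reduced w \<Longrightarrow> finite (to_quotient F2 \<psi> ` range (\<lambda>n. u \<cdot> g \<up> n \<cdot> w))"
proof -
  show *: "finite (to_quotient F2 \<psi> ` range (\<lambda>n. u \<cdot> g \<up> n \<cdot> w))"
    if "reduced u" "reduced w" for u w
    using finite_image_powers [of u g w m] g that by simp
  show "finite (to_quotient F2 \<psi> ` range (\<lambda>n. g \<up> n))"
    "\<And>u. reduced u \<Longrightarrow> finite (to_quotient F2 \<psi> ` range (\<lambda>n. u \<cdot> g \<up> n))"
    "\<And>w. reduced w \<Longrightarrow> finite (to_quotient F2 \<psi> ` range (\<lambda>n. g \<up> n \<cdot> w))"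
    using * [of \<epsilon> \<epsilon>] * [of _ \<epsilon>] * [of \<epsilon>] g(3) by simp_all
qed

end

text \<open>
  In the next four proofs \<open>S\<close> and \<open>M\<close> instantiate \<open>absorbing_if_products_in\<close>; the fact
  \<open>ball\<close> splits a statement about all of \<open>M\<close> into one statement per family.
\<close>

lemma nucleus_claim_1: "nucleus_claim 1"
proof -
  define \<psi> where "\<psi> = recursion 1"
  interpret f2_recursion \<psi> \<epsilon> \<alpha> \<beta>
    unfolding \<psi>_def by (rule f2_recursion_recursion) (simp_all add: gen_images_def)
  \<comment> \<open>\<open>\<alpha>\<close> has trivial restrictions but moves the letters, so the exponent is split by parity.\<close>
  have \<alpha>_pow: "fst (\<psi> (\<alpha> \<up> n)) x = \<epsilon>" for n x
  proof -
    have "fst (\<psi> ((\<alpha> \<cdot> \<alpha>) \<up> k)) x = \<epsilon> \<and> snd (\<psi> ((\<alpha> \<cdot> \<alpha>) \<up> k)) x = x" for k :: int and x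
      using section_pow_fixed [of "\<alpha> \<cdot> \<alpha>" x k] by (cases x) (simp_all add: section_mult)
    moreover have "\<alpha> \<up> n = (\<alpha> \<cdot> \<alpha>) \<up> (n div 2) \<cdot> \<alpha> \<up> (n mod 2)"
      by (simp flip: F2_pow_2 add: F2.int_pow_pow F2.int_pow_mult [symmetric])
    moreover have "n mod 2 = 0 \<or> n mod 2 = 1" by auto
    ultimately show ?thesis
      by (cases x) (auto simp: section_mult F2.int_pow_1)
  qed
  define M where "M = (\<Union>n. {\<alpha> \<up> n, beta_pow n})"
  have ball: "(\<forall>g \<in> M. P g) \<longleftrightarrow> (\<forall>n. P (\<alpha> \<up> n)) \<and> (\<forall>n. P (beta_pow n))" for P
    by (auto simp: M_def)
  have mem: "\<alpha> \<up> n \<in> M" "beta_pow n \<in> M" for n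
    by (auto simp: M_def)
  have mem0: "\<epsilon> \<in> M" "\<alpha> \<in> M" "\<alpha>' \<in> M"
    using mem(1) [of 0] mem(1) [of 1] mem(1) [of "-1"]
    by (simp_all add: F2.int_pow_1 F2.int_pow_neg)
  define S where "S = {\<epsilon>, \<alpha>, \<alpha>', beta_pow 1, beta_pow (-1)}"
  note simps = all_letter section_mult F2_normalise \<beta>_beta_pow \<alpha>_pow F2.int_pow_1 F2.int_pow_neg
  have 1: "\<forall>s \<in> S. \<forall>x. fst (\<psi> s) x \<in> S"
    unfolding S_def by (simp add: simps)
  have 2: "\<forall>g \<in> M. sections_in \<psi> M 1 g"
    unfolding ball by (simp add: simps mem mem0)
  have 3: "\<forall>s \<in> S. \<forall>g \<in> M. sections_in \<psi> M 1 (s \<cdot> g)"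
    unfolding ball S_def by (simp add: simps mem mem0)
  have S: "finite S" "\<alpha> \<in> S" "\<alpha>' \<in> S" "beta_pow 1 \<in> S" "beta_pow (-1) \<in> S" "\<forall>s \<in> S. reduced s"
    by (simp_all add: S_def)
  have M: "\<forall>g \<in> M. reduced g"
    unfolding ball by simp
  note absorbing = absorbing_if_products_in [OF S(1-5) 1 S(6) mem0(1) M 2 3]
  have "{\<epsilon>, \<alpha> \<cdot> \<alpha>, \<beta> \<cdot> \<beta>} \<subseteq> action_kernel F2 \<psi>"
    by (rule subset_action_kernel) (simp_all add: all_letter section_mult)
  then have orders: "\<alpha> [^]\<^bsub>F2\<^esub> (2::nat) \<in> action_kernel F2 \<psi>" "\<beta> [^]\<^bsub>F2\<^esub> (2::nat) \<in> action_kernel F2 \<psi>"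
    by (simp_all add: numeral_2_eq_2)
  have listed: "listed_nucleus 1 = M"
    using mem0(1) by (simp add: listed_nucleus_def M_def beta_pow_def insert_absorb)
  have fin: "finite (to_quotient F2 \<psi> ` M)"
    using finite_image_family(1) [OF orders(1)] finite_image_family(1) [OF orders(2)]
    by (simp add: M_def UN_insert_family image_Un beta_pow_def)
  have "beta_pow n \<in> recurrent F2 \<psi>" for n
    by (rule recurrent_if_mutual [of "beta_pow n" F2 "beta_pow n" \<psi> L2 L2]) (simp_all add: simps)
  moreover from this have "\<alpha> \<up> n \<in> recurrent F2 \<psi>" for n
    using section_recurrent [of "beta_pow n" F2 \<psi> L1] by simp
  ultimately have "M \<subseteq> recurrent F2 \<psi>"
    by (auto simp: M_def)
  then show ?thesis
    using absorbing fin \<psi>_def unfolding listed [symmetric]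
    by (intro nucleus_claimI [of 1 "listed_nucleus 1"]) auto
qed

lemma nucleus_claim_7: "nucleus_claim 7"
proof -
  interpret f2_recursion "recursion 7" \<alpha> \<beta> \<epsilon>
    by (rule f2_recursion_recursion) (simp_all add: gen_images_def)
  let ?\<psi> = "recursion 7"
  define M where "M = (\<Union>n. {beta_pow n, \<alpha> \<cdot> beta_pow n, beta_pow n \<cdot> \<alpha>', \<alpha> \<cdot> (beta_pow n \<cdot> \<alpha>')})"
  have ball: "(\<forall>g \<in> M. P g) \<longleftrightarrow> (\<forall>n. P (beta_pow n)) \<and> (\<forall>n. P (\<alpha> \<cdot> beta_pow n)) \<and>
      (\<forall>n. P (beta_pow n \<cdot> \<alpha>')) \<and> (\<forall>n. P (\<alpha> \<cdot> (beta_pow n \<cdot> \<alpha>')))" for P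
    by (auto simp: M_def)
  have mem: "beta_pow n \<in> M" "\<alpha> \<cdot> beta_pow n \<in> M" "beta_pow n \<cdot> \<alpha>' \<in> M" "\<alpha> \<cdot> (beta_pow n \<cdot> \<alpha>') \<in> M" for n
    by (auto simp: M_def)
  have mem0: "\<epsilon> \<in> M" "\<alpha> \<in> M" "\<alpha>' \<in> M"
    using mem(1-3) [of 0] by simp_all
  define S where "S = {\<epsilon>, \<alpha>, \<alpha>', beta_pow 1, beta_pow (-1)}"
  note simps = all_letter section_mult F2_normalise \<beta>_beta_pow
  have 1: "\<forall>s \<in> S. \<forall>x. fst (?\<psi> s) x \<in> S"
    unfolding S_def by (simp add: simps)
  have 2: "\<forall>g \<in> M. sections_in ?\<psi> M 1 g"
    unfolding ball by (simp add: simps mem mem0)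
  have 3: "\<forall>s \<in> S. \<forall>g \<in> M. sections_in ?\<psi> M 1 (s \<cdot> g)"
    unfolding ball S_def by (simp add: simps mem mem0)
  have S: "finite S" "\<alpha> \<in> S" "\<alpha>' \<in> S" "beta_pow 1 \<in> S" "beta_pow (-1) \<in> S" "\<forall>s \<in> S. reduced s"
    by (simp_all add: S_def)
  have M: "\<forall>g \<in> M. reduced g"
    unfolding ball by simp
  note absorbing = absorbing_if_products_in [OF S(1-5) 1 S(6) mem0(1) M 2 3]
  have "{\<epsilon>, \<beta>} \<subseteq> action_kernel F2 ?\<psi>"
    by (rule subset_action_kernel) (simp_all add: simps)
  then have \<beta>: "\<beta> [^]\<^bsub>F2\<^esub> (1::nat) \<in> action_kernel F2 ?\<psi>" by simp
  define B where "B = {\<epsilon>, \<alpha>} \<union> (\<Union>n. {\<beta> \<up> n, \<alpha> \<cdot> \<beta> \<up> n, \<alpha> \<cdot> \<beta> \<up> n \<cdot> \<alpha>'})"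
  have listed: "listed_nucleus 7 = pm B"
    by (simp add: listed_nucleus_def B_def)
  have B: "B \<subseteq> carrier F2"
    by (auto simp: B_def)
  have fin: "finite (to_quotient F2 ?\<psi> ` listed_nucleus 7)"
    unfolding listed using finite_image_family [OF \<beta>] B
    by (intro finite_image_pm) (simp_all add: B_def UN_insert_family image_Un)
  have "B \<subseteq> recurrent F2 ?\<psi>"
  proof -
    \<comment> \<open>Each of these words is its own restriction at one of the two letters.\<close>
    have "g \<in> recurrent F2 ?\<psi>" if "g \<in> {beta_pow n, \<alpha> \<cdot> beta_pow n, \<alpha> \<cdot> (beta_pow n \<cdot> \<alpha>')}" for g n
      using that recurrent_if_mutual [of g F2 g ?\<psi> L1 L1] recurrent_if_mutual [of g F2 g ?\<psi> L2 L2]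
      by (auto simp: simps)
    note * = this
    have "\<epsilon> \<in> recurrent F2 ?\<psi>" "\<alpha> \<in> recurrent F2 ?\<psi>"
      using * [of \<epsilon> 0] * [of \<alpha> 0] by simp_all
    with * show ?thesis
      by (auto simp: B_def beta_pow_def F2.m_assoc)
  qed
  then have rec: "listed_nucleus 7 \<subseteq> recurrent F2 ?\<psi>"
    unfolding listed by (rule pm_recurrent)
  have "\<forall>g \<in> M. g \<in> pm B"
    unfolding ball using B
    by (auto simp: pm_iff F2_normalise B_def beta_pow_def [symmetric])
  then have sub: "M \<subseteq> listed_nucleus 7" unfolding listed by blast
  show ?thesis
    using absorbing finite_subset [OF image_mono [OF sub] fin] fin sub rec
    by (intro nucleus_claimI [of 7 M]) auto
qed

lemma nucleus_claim_11: "nucleus_claim 11"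
proof -
  interpret f2_recursion "recursion 11" \<gamma> \<epsilon> \<beta>
    by (rule f2_recursion_recursion) (simp_all add: gen_images_def)
  let ?\<psi> = "recursion 11"
  define M where "M = {\<alpha>, \<alpha>', beta_pow (-1) \<cdot> \<alpha>', \<alpha> \<cdot> beta_pow 1} \<union> range beta_pow"
  have ball: "(\<forall>g \<in> M. P g) \<longleftrightarrow> P \<alpha> \<and> P \<alpha>' \<and> P (beta_pow (-1) \<cdot> \<alpha>') \<and> P (\<alpha> \<cdot> beta_pow 1) \<and> (\<forall>n. P (beta_pow n))" for P
    by (auto simp: M_def)
  have mem: "beta_pow n \<in> M" "\<alpha> \<in> M" "\<alpha>' \<in> M" "beta_pow (-1) \<cdot> \<alpha>' \<in> M" "\<alpha> \<cdot> beta_pow 1 \<in> M" for n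
    by (auto simp: M_def)
  have mem0: "\<epsilon> \<in> M"
    using mem(1) [of 0] by simp_all
  define S where "S = {\<epsilon>, \<alpha>, \<alpha>', beta_pow 1, beta_pow (-1), beta_pow (-1) \<cdot> \<alpha>', \<alpha> \<cdot> beta_pow 1}"
  note simps = all_letter section_mult F2_normalise \<beta>_beta_pow \<gamma>_def
  have 1: "\<forall>s \<in> S. \<forall>x. fst (?\<psi> s) x \<in> S"
    unfolding S_def by (simp add: simps)
  have 2: "\<forall>g \<in> M. sections_in ?\<psi> M 1 g"
    unfolding ball by (simp add: simps mem mem0)
  have 3: "\<forall>s \<in> S. \<forall>g \<in> M. sections_in ?\<psi> M 3 (s \<cdot> g)"
    unfolding ball S_def numeral_3_eq_3 by (simp add: simps mem mem0)
  have S: "finite S" "\<alpha> \<in> S" "\<alpha>' \<in> S" "beta_pow 1 \<in> S" "beta_pow (-1) \<in> S" "\<forall>s \<in> S. reduced s"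
    by (simp_all add: S_def)
  have M: "\<forall>g \<in> M. reduced g"
    unfolding ball by simp
  note absorbing = absorbing_if_products_in [OF S(1-5) 1 S(6) mem0(1) M 2 3]
  have "{\<epsilon>, \<beta>} \<subseteq> action_kernel F2 ?\<psi>"
    by (rule subset_action_kernel) (simp_all add: simps)
  then have \<beta>: "\<beta> [^]\<^bsub>F2\<^esub> (1::nat) \<in> action_kernel F2 ?\<psi>" by simp
  define B where "B = {\<epsilon>, \<alpha>, \<gamma>} \<union> (\<Union>n. {\<beta> \<up> n})"
  have listed: "listed_nucleus 11 = pm B"
    by (simp add: listed_nucleus_def B_def)
  have B: "B \<subseteq> carrier F2"
    by (auto simp: B_def)
  have fin: "finite (to_quotient F2 ?\<psi> ` listed_nucleus 11)"
    unfolding listed using finite_image_family [OF \<beta>] B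
    by (intro finite_image_pm) (simp_all add: B_def UN_insert_family image_Un)
  have "\<forall>g \<in> M. g \<in> pm B"
    unfolding ball using B
    by (auto simp: pm_iff F2_normalise B_def beta_pow_def [symmetric] \<beta>_beta_pow \<gamma>_def)
  then have sub: "M \<subseteq> listed_nucleus 11" unfolding listed by blast
  show ?thesis
    using absorbing finite_subset [OF image_mono [OF sub] fin] fin sub
    by (intro nucleus_claimI [of 11 M]) auto
qed

lemma nucleus_claim_10: "nucleus_claim 10"
proof -
  interpret f2_recursion "recursion 10" \<delta> \<epsilon> "\<alpha>' \<cdot> (\<beta> \<cdot> \<alpha>)"
    by (rule f2_recursion_recursion) (simp_all add: gen_images_def F2.m_assoc)
  let ?\<psi> = "recursion 10"
  define M where "M = (\<Union>n. {beta_pow n, \<alpha>' \<cdot> (beta_pow n \<cdot> \<alpha>), beta_pow n \<cdot> \<alpha>, \<alpha>' \<cdot> beta_pow n})"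
  have ball: "(\<forall>g \<in> M. P g) \<longleftrightarrow> (\<forall>n. P (beta_pow n)) \<and> (\<forall>n. P (\<alpha>' \<cdot> (beta_pow n \<cdot> \<alpha>))) \<and>
      (\<forall>n. P (beta_pow n \<cdot> \<alpha>)) \<and> (\<forall>n. P (\<alpha>' \<cdot> beta_pow n))" for P
    by (auto simp: M_def)
  have mem: "beta_pow n \<in> M" "\<alpha>' \<cdot> (beta_pow n \<cdot> \<alpha>) \<in> M" "beta_pow n \<cdot> \<alpha> \<in> M" "\<alpha>' \<cdot> beta_pow n \<in> M" for n
    by (auto simp: M_def)
  have mem0: "\<epsilon> \<in> M" "\<alpha> \<in> M" "\<alpha>' \<in> M"
    using mem(1,3,4) [of 0] by simp_all
  define S where "S = {\<epsilon>, \<alpha>, \<alpha>', beta_pow 1, beta_pow (-1), \<alpha>' \<cdot> beta_pow (-1), beta_pow 1 \<cdot> \<alpha>,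
    \<alpha>' \<cdot> (beta_pow 1 \<cdot> \<alpha>), \<alpha>' \<cdot> (beta_pow (-1) \<cdot> \<alpha>)}"
  note simps = all_letter section_mult F2_normalise \<beta>_beta_pow \<delta>_def conj_pow
  have 1: "\<forall>s \<in> S. \<forall>x. fst (?\<psi> s) x \<in> S"
    unfolding S_def by (simp add: simps)
  have 2: "\<forall>g \<in> M. sections_in ?\<psi> M 1 g"
    unfolding ball by (simp add: simps mem mem0)
  have 3: "\<forall>s \<in> S. \<forall>g \<in> M. sections_in ?\<psi> M 1 (s \<cdot> g)"
    unfolding ball S_def by (simp add: simps mem mem0)
  have S: "finite S" "\<alpha> \<in> S" "\<alpha>' \<in> S" "beta_pow 1 \<in> S" "beta_pow (-1) \<in> S" "\<forall>s \<in> S. reduced s"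
    by (simp_all add: S_def)
  have M: "\<forall>g \<in> M. reduced g"
    unfolding ball by simp
  note absorbing = absorbing_if_products_in [OF S(1-5) 1 S(6) mem0(1) M 2 3]
  have "{\<epsilon>, \<beta>, \<alpha>' \<cdot> (\<beta> \<cdot> \<alpha>)} \<subseteq> action_kernel F2 ?\<psi>"
    by (rule subset_action_kernel) (simp_all add: simps)
  then have \<beta>: "\<beta> [^]\<^bsub>F2\<^esub> (1::nat) \<in> action_kernel F2 ?\<psi>" by simp
  define B where "B = {\<epsilon>, \<alpha>} \<union> (\<Union>n. {\<beta> \<up> n, \<alpha>' \<cdot> \<beta> \<up> n \<cdot> \<alpha>, \<beta> \<up> n \<cdot> \<alpha>})"
  have listed: "listed_nucleus 10 = pm B"
    by (simp add: listed_nucleus_def B_def)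
  have B: "B \<subseteq> carrier F2"
    by (auto simp: B_def)
  have fin: "finite (to_quotient F2 ?\<psi> ` listed_nucleus 10)"
    unfolding listed using finite_image_family [OF \<beta>] B
    by (intro finite_image_pm) (simp_all add: B_def UN_insert_family image_Un)
  have "B \<subseteq> recurrent F2 ?\<psi>"
  proof -
    have **: "beta_pow n \<in> recurrent F2 ?\<psi>" "\<alpha>' \<cdot> (beta_pow n \<cdot> \<alpha>) \<in> recurrent F2 ?\<psi>" for n
      by (rule recurrent_if_mutual [of "beta_pow n" F2 "\<alpha>' \<cdot> (beta_pow n \<cdot> \<alpha>)" ?\<psi> L2 L1]; simp add: simps)+
    \<comment> \<open>The partner \<open>\<alpha>\<^sup>-\<^sup>1 \<beta>\<^sup>n\<^sup>-\<^sup>1\<close> is the inverse of another member of the same family.\<close>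
    moreover have *: "beta_pow n \<cdot> \<alpha> \<in> recurrent F2 ?\<psi>" for n
      by (rule recurrent_if_mutual [of "beta_pow n \<cdot> \<alpha>" F2 "\<alpha>' \<cdot> beta_pow (n - 1)" ?\<psi> L2 L1]) (simp_all add: simps)
    moreover from **(1) [of 0] * [of 0] have "\<epsilon> \<in> recurrent F2 ?\<psi>" "\<alpha> \<in> recurrent F2 ?\<psi>"
      by simp_all
    ultimately show ?thesis
      by (auto simp: B_def beta_pow_def [symmetric] F2.m_assoc)
  qed
  then have rec: "listed_nucleus 10 \<subseteq> recurrent F2 ?\<psi>"
    unfolding listed by (rule pm_recurrent)
  have "\<forall>g \<in> M. g \<in> pm B"
    unfolding ball using B
    by (auto simp: pm_iff F2_normalise B_def beta_pow_def [symmetric] \<beta>_beta_pow \<gamma>_def)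
  then have sub: "M \<subseteq> listed_nucleus 10" unfolding listed by blast
  show ?thesis
    using absorbing finite_subset [OF image_mono [OF sub] fin] fin sub rec
    by (intro nucleus_claimI [of 10 M]) auto
qed


section \<open>Recursions from division of Gaussian integers\<close>

text \<open>
  The letters act on the plane from the right, like the group on the tree.  Both letters
  preserve the Gaussian integers; the group they generate is the rotation group
  of type \<open>(2, 4, 4)\<close>.
\<close>

fun letter_map :: "gen \<times> bool \<Rightarrow> complex \<Rightarrow> complex" where
  "letter_map (Gen_alpha, s) z = 1 - z"
| "letter_map (Gen_beta, s) z = (if s then \<i> * z else - \<i> * z)"

definition plane_map :: "gen word \<Rightarrow> complex \<Rightarrow> complex" where
  "plane_map w z = fold letter_map w z"

lemma gen_letter_cases:
  obtains (alpha) s where "l = (Gen_alpha, s)" | (beta) s where "l = (Gen_beta, s)"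
  by (metis gen.exhaust surj_pair)

lemma letter_map_inv: "letter_map (inv_letter l) (letter_map l z) = z"
  by (cases l rule: gen_letter_cases) (auto simp: inv_letter_def algebra_simps)

lemma plane_map_push: "plane_map (push l w) z = plane_map w (letter_map l z)"
  by (cases w) (auto simp: plane_map_def letter_map_inv)

lemma plane_map_mult: "plane_map (u \<cdot> v) z = plane_map v (plane_map u z)"
  unfolding F2_mult
  by (induction u arbitrary: z) (auto simp: plane_map_push, simp_all add: plane_map_def)

lemma plane_map_one: "plane_map \<epsilon> z = z"
  by (simp add: plane_map_def F2_one)

lemma plane_map_inv:
  assumes "reduced w" shows "plane_map (inv\<^bsub>F2\<^esub> w) (plane_map w z) = z"
    "plane_map w (plane_map (inv\<^bsub>F2\<^esub> w) z) = z"
  using plane_map_mult [of w "inv\<^bsub>F2\<^esub> w" z] plane_map_mult [of "inv\<^bsub>F2\<^esub> w" w z] assms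
  by (simp_all add: plane_map_one)

lemma plane_map_\<alpha>: "plane_map \<alpha> z = 1 - z" "plane_map \<alpha>' z = 1 - z"
  and plane_map_\<beta>: "plane_map \<beta> z = \<i> * z" "plane_map \<beta>' z = - \<i> * z"
  by (simp_all add: F2_inv) (simp_all add: plane_map_def \<alpha>_def \<beta>_def word_inv_def inv_letter_def)

lemma plane_map_letter: "plane_map [l] z = letter_map l z"
  by (simp add: plane_map_def)

lemma cmod_plane_map_diff: "cmod (plane_map w y - plane_map w z) = cmod (y - z)"
proof (induction w arbitrary: y z)
  case (Cons l w)
  have "cmod (letter_map l y - letter_map l z) = cmod (y - z)"
  proof (cases l rule: gen_letter_cases)
    case (alpha s)
    then show ?thesis by (simp add: norm_minus_commute)
  next
    case (beta s)
    have "cmod (t * y - t * z) = cmod (y - z)" if "cmod t = 1" for t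
      using that by (simp flip: right_diff_distrib add: norm_mult)
    from this [of \<i>] this [of "- \<i>"]
    show ?thesis using beta by simp
  qed
  then show ?case using Cons by (simp add: plane_map_def)
qed (simp add: plane_map_def)

definition gauss_ints :: "complex set" where
  "gauss_ints = {p. Re p \<in> \<int> \<and> Im p \<in> \<int>}"

lemma gauss_int_closed:
  "0 \<in> gauss_ints" "1 \<in> gauss_ints"
  "p \<in> gauss_ints \<Longrightarrow> q \<in> gauss_ints \<Longrightarrow> p + q \<in> gauss_ints"
  "p \<in> gauss_ints \<Longrightarrow> - p \<in> gauss_ints"
  "p \<in> gauss_ints \<Longrightarrow> \<i> * p \<in> gauss_ints"
  by (simp_all add: gauss_ints_def)

lemma gauss_int_cases:
  assumes "p \<in> gauss_ints"
  obtains x y :: int where "p = Complex (of_int x) (of_int y)"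
  using assms unfolding gauss_ints_def by (auto elim!: Ints_cases simp: complex_eq_iff)

lemma finite_gauss_ints_bounded: "finite {p \<in> gauss_ints. cmod p \<le> r}"
proof (rule finite_subset)
  let ?I = "{- \<lceil>r\<rceil>..\<lceil>r\<rceil>}"
  show "{p \<in> gauss_ints. cmod p \<le> r} \<subseteq> (\<lambda>(x, y). Complex (of_int x) (of_int y)) ` (?I \<times> ?I)"
  proof
    fix p assume "p \<in> {p \<in> gauss_ints. cmod p \<le> r}"
    then obtain x y where p: "p = Complex (of_int x) (of_int y)" "cmod p \<le> r"
      by (auto elim: gauss_int_cases)
    then have "\<bar>real_of_int x\<bar> \<le> r" "\<bar>real_of_int y\<bar> \<le> r"
      using abs_Re_le_cmod [of p] abs_Im_le_cmod [of p] by auto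
    then have "x \<in> ?I" "y \<in> ?I" by (auto simp: abs_le_iff) linarith+
    then show "p \<in> (\<lambda>(x, y). Complex (of_int x) (of_int y)) ` (?I \<times> ?I)"
      using p(1) by auto
  qed
qed simp

lemma plane_map_affine:
  "\<exists>u \<in> {1, -1, \<i>, -\<i>}. \<forall>z. plane_map w z = u * z + plane_map w 0"
  "plane_map w 0 \<in> gauss_ints"
proof -
  have *: "\<exists>u \<in> {1, -1, \<i>, -\<i>}. \<exists>p \<in> gauss_ints. \<forall>z. plane_map w z = u * z + p"
  proof (induction w rule: rev_induct)
    case Nil
    have "plane_map [] z = 1 * z + 0" for z
      by (simp add: plane_map_def)
    then show ?case using gauss_int_closed(1) by blast
  next
    case (snoc l w)
    then obtain u p where u: "u \<in> {1, -1, \<i>, -\<i>}" "p \<in> gauss_ints" "\<And>z. plane_map w z = u * z + p"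
      by blast
    have step: "plane_map (w @ [l]) z = letter_map l (u * z + p)" for z
      using u(3) by (simp add: plane_map_def)
    show ?case
    proof (cases l rule: gen_letter_cases)
      case (alpha s)
      have "1 + - p \<in> gauss_ints" using u(2) gauss_int_closed by blast
      moreover have "- u \<in> {1, -1, \<i>, -\<i>}" using u(1) by auto
      moreover have "plane_map (w @ [l]) z = - u * z + (1 + - p)" for z
        using step [of z] by (simp add: alpha)
      ultimately show ?thesis by blast
    next
      case (beta s)
      define t where "t = (if s then \<i> else - \<i>)"
      have "t * p \<in> gauss_ints"
        using u(2) gauss_int_closed(4,5) by (auto simp: t_def)
      moreover have "t * u \<in> {1, -1, \<i>, -\<i>}" using u(1) by (auto simp: t_def)
      moreover have "plane_map (w @ [l]) z = (t * u) * z + t * p" for z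
        using step [of z] by (simp add: beta t_def algebra_simps)
      ultimately show ?thesis by blast
    qed
  qed
  then show "plane_map w 0 \<in> gauss_ints" by auto
  show "\<exists>u \<in> {1, -1, \<i>, -\<i>}. \<forall>z. plane_map w z = u * z + plane_map w 0"
    using * by auto
qed

lemma cmod_gauss_int: assumes "p \<in> gauss_ints" shows "\<exists>k::int. (cmod p)\<^sup>2 = of_int k"
proof -
  obtain x y where "p = Complex (of_int x) (of_int y)"
    using assms by (rule gauss_int_cases)
  then have "(cmod p)\<^sup>2 = of_int (x\<^sup>2 + y\<^sup>2)" by (simp add: cmod_power2)
  then show ?thesis by blast
qed

text \<open>
  The two maps \<open>frame lam x\<close> identify the plane seen from vertex \<open>x\<close> with the plane at the root.
  When \<open>lam\<close> is a Gaussian integer of norm \<open>2\<close>, the images of the Gaussian integers under them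
  are the two residue classes modulo \<open>lam\<close>.
\<close>

fun frame :: "complex \<Rightarrow> letter \<Rightarrow> complex \<Rightarrow> complex" where
  "frame lam L1 z = 1 - lam * z"
| "frame lam L2 z = lam * z"

text \<open>
  The equation for \<open>b\<close> says that \<open>frame\<close> intertwines \<open>\<beta>\<close> with its restriction \<open>b\<close> at the first
  letter.  The other letters are intertwined automatically: \<open>z \<mapsto> \<i> z\<close> commutes with multiplication by \<open>lam\<close>,
  and \<open>z \<mapsto> 1 - z\<close> exchanges the two frames.
\<close>

locale lattes_recursion = f2_recursion \<psi> \<epsilon> b \<beta> for \<psi> b +
  fixes lam :: complex
  assumes frame_b: "\<And>z. \<i> * (1 - lam * z) = 1 - lam * plane_map b z"
    and cmod_lam: "cmod lam = sqrt 2"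
begin

lemma lam_nonzero: "lam \<noteq> 0"
  using cmod_lam by auto

lemma frame_inv_b: "- \<i> * (1 - lam * z) = 1 - lam * plane_map (inv\<^bsub>F2\<^esub> b) z"
proof -
  have "\<i> * (1 - lam * plane_map (inv\<^bsub>F2\<^esub> b) z) = 1 - lam * z"
    using frame_b [of "plane_map (inv\<^bsub>F2\<^esub> b) z"] by (simp add: plane_map_inv)
  then have "- \<i> * (\<i> * (1 - lam * plane_map (inv\<^bsub>F2\<^esub> b) z)) = - \<i> * (1 - lam * z)" by simp
  then show ?thesis by (simp flip: mult.assoc)
qed

lemma plane_map_frame:
  assumes "reduced w"
  shows "plane_map w (frame lam x z) = frame lam (snd (\<psi> w) x) (plane_map (fst (\<psi> w) x) z)"
  using assms
proof (induction w arbitrary: x z rule: reduced_induct)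
  case Nil
  show ?case by (simp add: plane_map_one)
next
  case (Cons l w)
  have "plane_map [l] (frame lam x z) = frame lam (snd (\<psi> [l]) x) (plane_map (fst (\<psi> [l]) x) z)"
    using frame_b [of z] frame_inv_b [of z]
    by (cases l rule: letter_F2_cases; cases x)
       (simp_all add: plane_map_\<alpha> plane_map_\<beta> plane_map_one algebra_simps)
  then show ?case
    using Cons by (simp add: plane_map_mult section_mult)
qed

text \<open>
  The two residue classes are disjoint because \<open>1 = lam * (p + q)\<close> would give \<open>1\<close> an even norm.
\<close>

lemma frame_eqD:
  assumes "p \<in> gauss_ints" "q \<in> gauss_ints" "frame lam x p = frame lam y q"
  shows "x = y \<and> p = q"
proof (cases "x = y")
  case True
  then show ?thesis using assms(3) lam_nonzero by (cases x) auto
next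
  case False
  then have "lam * (p + q) = 1"
    using assms(3) by (cases x; cases y) (auto simp: algebra_simps)
  then have "(cmod lam)\<^sup>2 * (cmod (p + q))\<^sup>2 = 1"
    by (metis norm_mult norm_one power_mult_distrib power_one)
  moreover obtain k :: int where "(cmod (p + q))\<^sup>2 = of_int k"
    using cmod_gauss_int gauss_int_closed(3) assms(1,2) by blast
  ultimately have "2 * real_of_int k = 1" by (simp add: cmod_lam)
  then have "2 * k = 1" by linarith
  then show ?thesis by presburger
qed

text \<open>
  Hence a word whose isometry is known has known permutation and known restricted isometries, and
  the isometry determines the action on the tree.
\<close>

lemma same_plane_map_section:
  assumes "reduced g" "reduced h" "plane_map g = plane_map h"
  shows "snd (\<psi> g) x = snd (\<psi> h) x" "plane_map (fst (\<psi> g) x) = plane_map (fst (\<psi> h) x)"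
proof -
  have eq: "frame lam (snd (\<psi> g) x) (plane_map (fst (\<psi> g) x) z) =
      frame lam (snd (\<psi> h) x) (plane_map (fst (\<psi> h) x) z)" for z
    using plane_map_frame [of g x z] plane_map_frame [of h x z] assms by simp
  show 1: "snd (\<psi> g) x = snd (\<psi> h) x"
    using frame_eqD [OF plane_map_affine(2) plane_map_affine(2) eq [of 0]] by blast
  have "plane_map (fst (\<psi> g) x) z = plane_map (fst (\<psi> h) x) z" for z
    using eq [of z] lam_nonzero unfolding 1 by (cases "snd (\<psi> h) x") auto
  then show "plane_map (fst (\<psi> g) x) = plane_map (fst (\<psi> h) x)" ..
qed

lemma same_plane_map_same_coset:
  assumes "reduced g" "reduced h" "plane_map g = plane_map h"
  shows "to_quotient F2 \<psi> g = to_quotient F2 \<psi> h"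
proof -
  have "tree_action \<psi> g v = tree_action \<psi> h v" for v
    by (rule tree_action_bisim [where R = "\<lambda>g h. reduced g \<and> reduced h \<and> plane_map g = plane_map h"])
       (use assms same_plane_map_section in auto)
  then show ?thesis using assms by (simp add: same_coset_iff)
qed

text \<open>
  By \<open>plane_map_frame\<close> the displacement of the origin is divided by \<open>lam\<close>, up to the offsets \<open>1\<close> of the
  two frames; \<open>3 / 4\<close> is a rational bound for \<open>1 / sqrt 2\<close>.
\<close>

lemma cmod_section:
  assumes "reduced w"
  shows "cmod (plane_map (fst (\<psi> w) x) 0) \<le> 3 / 4 * (cmod (plane_map w 0) + 2)"
proof -
  let ?p = "plane_map (fst (\<psi> w) x) 0"
  have frame: "cmod lam * cmod p \<le> cmod (frame lam y p) + 1" for y p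
    using norm_triangle_ineq4 [of 1 "1 - lam * p"] by (cases y) (auto simp: norm_mult)
  have "cmod (plane_map w (frame lam x 0) - plane_map w 0) \<le> 1"
    unfolding cmod_plane_map_diff by (cases x) auto
  then have "cmod (plane_map w (frame lam x 0)) \<le> cmod (plane_map w 0) + 1"
    using norm_triangle_sub [of "plane_map w (frame lam x 0)" "plane_map w 0"] by linarith
  then have "sqrt 2 * cmod ?p \<le> cmod (plane_map w 0) + 2"
    using frame [of ?p "snd (\<psi> w) x"] plane_map_frame [OF assms, of x 0] cmod_lam by simp
  moreover have "4 / 3 * cmod ?p \<le> sqrt 2 * cmod ?p"
    by (intro mult_right_mono real_le_rsqrt) (auto simp: power2_eq_square)
  ultimately have "4 / 3 * cmod ?p \<le> cmod (plane_map w 0) + 2" by simp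
  then show ?thesis by simp
qed

text \<open>The constant \<open>6\<close> is the fixed point of \<open>r \<mapsto> 3 / 4 * (r + 2)\<close>.\<close>

lemma cmod_restriction:
  "reduced w \<Longrightarrow>
    cmod (plane_map (restriction \<psi> w v) 0) \<le> 6 + (3 / 4) ^ length v * (cmod (plane_map w 0) - 6)"
proof (induction v arbitrary: w)
  case (Cons x v)
  have "(3 / 4) ^ length v * (cmod (plane_map (fst (\<psi> w) x) 0) - 6) \<le>
      (3 / 4) ^ length v * (3 / 4 * (cmod (plane_map w 0) - 6))"
    using cmod_section [OF Cons.prems, of x] by (intro mult_left_mono) auto
  moreover have "cmod (plane_map (restriction \<psi> (fst (\<psi> w) x) v) 0) \<le>
      6 + (3 / 4) ^ length v * (cmod (plane_map (fst (\<psi> w) x) 0) - 6)"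
    using Cons by simp
  ultimately have "cmod (plane_map (restriction \<psi> (fst (\<psi> w) x) v) 0) \<le>
      6 + (3 / 4) ^ length v * (3 / 4 * (cmod (plane_map w 0) - 6))"
    by (meson add_left_mono order_trans)
  then show ?case by (simp only: restriction.simps list.size power_Suc2 mult.assoc add_0_right add_Suc_right)
qed simp

text \<open>Any radius above the fixed point \<open>6\<close> would do.\<close>

definition bounded_words :: "gen word set" where
  "bounded_words = {w. reduced w \<and> cmod (plane_map w 0) \<le> 7}"

lemma absorbing_bounded_words: "absorbing F2 \<psi> bounded_words"
  unfolding absorbing_def
proof (intro conjI ballI)
  show "bounded_words \<subseteq> carrier F2" by (auto simp: bounded_words_def)
  fix w assume "w \<in> carrier F2"
  then have w: "reduced w" by simp
  let ?c = "cmod (plane_map w 0)"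
  have "0 < 1 / (?c + 1)" by (intro divide_pos_pos add_nonneg_pos) auto
  then obtain n where n: "(3 / 4) ^ n < 1 / (?c + 1)"
    using real_arch_pow_inv [of "1 / (?c + 1)" "3 / 4"] by auto
  have "restriction \<psi> w v \<in> bounded_words" if v: "n \<le> length v" for v
  proof -
    have "(3 / 4 :: real) ^ length v \<le> (3 / 4) ^ n"
      using v by (intro power_decreasing) auto
    then have "(3 / 4) ^ length v \<le> 1 / (?c + 1)"
      using n by (meson less_imp_le order_trans)
    then have "(3 / 4) ^ length v * ?c \<le> 1 / (?c + 1) * (?c + 1)"
      by (intro mult_mono) auto
    moreover have "1 / (?c + 1) * (?c + 1) = 1"
      using norm_ge_zero [of "plane_map w 0"] by (simp add: add_nonneg_eq_0_iff)
    ultimately have "(3 / 4) ^ length v * ?c \<le> 1" by simp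
    moreover have "0 \<le> (3 / 4 :: real) ^ length v * 6" by simp
    ultimately have "cmod (plane_map (restriction \<psi> w v) 0) \<le> 7"
      using cmod_restriction [OF w, of v] unfolding right_diff_distrib by linarith
    then show ?thesis using w by (simp add: bounded_words_def)
  qed
  then show "\<exists>n. \<forall>v. n \<le> length v \<longrightarrow> restriction \<psi> w v \<in> bounded_words" by blast
qed

text \<open>
  An isometry \<open>z \<mapsto> u * z + p\<close> from these words has one of four values \<open>u\<close> and a bounded Gaussian
  integer \<open>p\<close>.
\<close>

lemma finite_image_bounded_words: "finite (to_quotient F2 \<psi> ` bounded_words)"
proof (rule finite_subset)
  let ?P = "(\<lambda>(u, p) z. u * z + p) ` ({1, -1, \<i>, -\<i>} \<times> {p \<in> gauss_ints. cmod p \<le> 7})"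
  have "plane_map ` bounded_words \<subseteq> ?P"
  proof
    fix f assume "f \<in> plane_map ` bounded_words"
    then obtain w where w: "f = plane_map w" "cmod (plane_map w 0) \<le> 7"
      by (auto simp: bounded_words_def)
    define p where "p = plane_map w 0"
    obtain u where u: "u \<in> {1, -1, \<i>, -\<i>}" "\<And>z. plane_map w z = u * z + p"
      using plane_map_affine(1) [of w] unfolding p_def by blast
    have "p \<in> {p \<in> gauss_ints. cmod p \<le> 7}"
      using w(2) plane_map_affine(2) [of w] by (simp add: p_def)
    moreover have "f = (\<lambda>(u, p) z. u * z + p) (u, p)"
      using w(1) u(2) by (simp add: fun_eq_iff)
    ultimately show "f \<in> ?P"
      using u(1) by blast
  qed
  then show "finite ((\<lambda>f. to_quotient F2 \<psi> (inv_into bounded_words plane_map f)) ` plane_map ` bounded_words)"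
    using finite_gauss_ints_bounded by (intro finite_imageI finite_subset [of _ ?P]) auto
  show "to_quotient F2 \<psi> ` bounded_words \<subseteq>
      (\<lambda>f. to_quotient F2 \<psi> (inv_into bounded_words plane_map f)) ` plane_map ` bounded_words"
  proof
    fix C assume "C \<in> to_quotient F2 \<psi> ` bounded_words"
    then obtain w where w: "w \<in> bounded_words" "C = to_quotient F2 \<psi> w" by blast
    define w' where "w' = inv_into bounded_words plane_map (plane_map w)"
    have "w' \<in> bounded_words" "plane_map w' = plane_map w"
      unfolding w'_def using w(1) by (auto intro: inv_into_into f_inv_into_f)
    then have "to_quotient F2 \<psi> w = to_quotient F2 \<psi> w'"
      using w(1) same_plane_map_same_coset [of w w'] by (simp add: bounded_words_def)
    then have "C = to_quotient F2 \<psi> (inv_into bounded_words plane_map (plane_map w))"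
      using w(2) by (simp only: w'_def)
    then show "C \<in> (\<lambda>f. to_quotient F2 \<psi> (inv_into bounded_words plane_map f)) ` plane_map ` bounded_words"
      using w(1) by blast
  qed
qed

lemma section_\<alpha>_one [simp]: "fst (\<psi> \<alpha>) x = \<epsilon>" "fst (\<psi> \<alpha>') x = \<epsilon>"
  by (cases x; simp)+

text \<open>\<open>\<beta>\<^sup>n\<close> is its own restriction at the second letter.\<close>

lemma \<beta>_pow_recurrent: "\<beta> \<up> n \<in> recurrent F2 \<psi>" "b \<up> n \<in> recurrent F2 \<psi>"
proof -
  show "\<beta> \<up> n \<in> recurrent F2 \<psi>"
    by (rule recurrent_if_mutual [of "\<beta> \<up> n" F2 "\<beta> \<up> n" \<psi> L2 L2]) simp_all
  then show "b \<up> n \<in> recurrent F2 \<psi>"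
    using section_recurrent [of "\<beta> \<up> n" F2 \<psi> L1] by simp
qed

text \<open>Here the listed set lies inside the nucleus, which settles the finiteness of its image.\<close>

lemma nucleus_claim_lattes:
  assumes "\<psi> = recursion i" "i \<in> {5, 6}"
    and "\<And>w. w \<in> carrier F2 \<Longrightarrow> finite (range (restriction \<psi> w))"
    and "listed_nucleus i \<subseteq> recurrent F2 \<psi>"
  shows "nucleus_claim i"
proof -
  have "finite (to_quotient F2 \<psi> ` listed_nucleus i)"
    by (rule finite_subset [OF image_mono nucleus_finite_in_quotient(3)])
       (use assms absorbing_bounded_words finite_image_bounded_words in auto)
  then show ?thesis
    using assms absorbing_bounded_words finite_image_bounded_words
    by (intro nucleus_claimI [of i bounded_words]) auto
qed

end

lemma odd_even_power:
  assumes "reduced g"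
  shows "g \<up> (2 * n) = (g \<cdot> g) \<up> n" "g \<up> (2 * n + 1) = (g \<cdot> g) \<up> n \<cdot> g"
  using assms by (simp_all flip: F2_pow_2 add: F2.int_pow_pow F2.int_pow_mult F2.int_pow_1)

text \<open>
  In the two remaining cases the families in \<open>\<alpha>\<^sup>n\<close> are restrictions of powers of \<open>\<gamma>\<close>
  and \<open>\<delta>\<close> respectively: the square of this element fixes the letters and has the restrictions
  \<open>\<alpha>\<close> and a conjugate of \<open>\<alpha>\<close>, so even and odd powers give the different families.  The value of
  \<open>lam\<close> is the solution of the equation in \<open>lattes_recursion\<close>.
\<close>

lemma nucleus_claim_5: "nucleus_claim 5"
proof -
  let ?\<psi> = "recursion 5"
  interpret f2_recursion ?\<psi> \<epsilon> \<gamma> \<beta>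
    by (rule f2_recursion_recursion) (simp_all add: gen_images_def)
  have \<gamma>: "plane_map \<gamma> z = \<i> * z + 1" for z
    by (simp add: \<gamma>_def plane_map_mult plane_map_\<alpha> plane_map_\<beta>)
  interpret lattes_recursion ?\<psi> \<gamma> "1 - \<i>"
    by unfold_locales (simp_all add: \<gamma> algebra_simps cmod_def)
  define S where "S = {\<epsilon>, \<alpha>, \<alpha>', \<beta>, \<beta>', \<gamma>, inv\<^bsub>F2\<^esub> \<gamma>}"
  note simps = all_letter section_mult F2.m_assoc F2.inv_mult_group F2_cancel
  have "\<forall>s \<in> S. \<forall>x. fst (?\<psi> s) x \<in> S"
    unfolding S_def by (simp add: simps \<gamma>_def)
  moreover have "[l] \<in> S" for l
    by (cases l rule: letter_F2_cases) (simp_all add: S_def)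
  moreover have "finite S" by (simp add: S_def)
  ultimately have fin: "finite (range (restriction ?\<psi> w))" if "w \<in> carrier F2" for w
    using finite_states [of S w] that by blast
  have \<gamma>\<gamma>: "fst (?\<psi> ((\<gamma> \<cdot> \<gamma>) \<up> n)) L1 = \<alpha> \<up> n" "snd (?\<psi> ((\<gamma> \<cdot> \<gamma>) \<up> n)) x = x"
    "fst (?\<psi> ((\<gamma> \<cdot> \<gamma>) \<up> n)) L2 = \<beta>' \<cdot> (\<alpha> \<up> n \<cdot> \<beta>)" for n x
    using section_pow_fixed [of "\<gamma> \<cdot> \<gamma>" L1 n] section_pow_fixed [of "\<gamma> \<cdot> \<gamma>" L2 n]
      section_pow_fixed [of "\<gamma> \<cdot> \<gamma>" x n]
    by (simp_all add: \<gamma>_def simps conj_pow)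
  let ?R = "recurrent F2 ?\<psi>"
  have even: "\<alpha> \<up> n \<in> ?R" "\<beta>' \<cdot> (\<alpha> \<up> n \<cdot> \<beta>) \<in> ?R" for n
    using section_recurrent [of "\<gamma> \<up> (2 * n)" F2 ?\<psi>] \<beta>_pow_recurrent(2)
    by (metis odd_even_power(1) reduced_generators(3) \<gamma>\<gamma>)+
  have odd: "\<alpha> \<up> n \<cdot> \<beta> \<in> ?R" for n
  proof -
    have "fst (?\<psi> (\<gamma> \<up> (2 * (- n) + 1))) L2 = inv\<^bsub>F2\<^esub> (\<alpha> \<up> n \<cdot> \<beta>)"
      unfolding odd_even_power(2) [OF reduced_generators(3)]
      by (simp add: section_mult \<gamma>\<gamma>) (simp add: \<gamma>_def simps F2.int_pow_neg)
    then have "inv\<^bsub>F2\<^esub> (\<alpha> \<up> n \<cdot> \<beta>) \<in> ?R"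
      using section_recurrent [OF \<beta>_pow_recurrent(2)] by metis
    then show ?thesis by (simp add: recurrent_inv_iff)
  qed
  \<comment> \<open>The isolated element \<open>\<alpha> \<cdot> \<beta>\<^sup>2\<close> is a restriction of a member of a family already treated.\<close>
  have "fst (?\<psi> (\<beta>' \<cdot> (\<alpha> \<up> (-1) \<cdot> \<beta>))) L1 = \<alpha> \<cdot> (\<beta> \<cdot> \<beta>)"
    by (simp add: F2.int_pow_neg F2.int_pow_1 simps \<gamma>_def)
  then have "\<alpha> \<cdot> (\<beta> \<cdot> \<beta>) \<in> ?R"
    using section_recurrent [OF even(2)] by metis
  moreover have "\<epsilon> \<in> ?R"
    using even(1) [of 0] by simp
  ultimately have "listed_nucleus 5 \<subseteq> ?R"
    unfolding listed_nucleus_def using even odd \<beta>_pow_recurrent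
    by (simp add: pm_recurrent UN_subset_iff F2_pow_2 F2.m_assoc)
  then show ?thesis
    using fin by (intro nucleus_claim_lattes) auto
qed

lemma nucleus_claim_6: "nucleus_claim 6"
proof -
  let ?\<psi> = "recursion 6"
  interpret f2_recursion ?\<psi> \<epsilon> \<delta> \<beta>
    by (rule f2_recursion_recursion) (simp_all add: gen_images_def)
  have \<delta>: "plane_map \<delta> z = \<i> * z - \<i>" for z
    by (simp add: \<delta>_def plane_map_mult plane_map_\<alpha> plane_map_\<beta> algebra_simps)
  interpret lattes_recursion ?\<psi> \<delta> "1 + \<i>"
    by unfold_locales (simp_all add: \<delta> algebra_simps cmod_def)
  define S where "S = {\<epsilon>, \<alpha>, \<alpha>', \<beta>, \<beta>', \<delta>, inv\<^bsub>F2\<^esub> \<delta>}"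
  note simps = all_letter section_mult F2.m_assoc F2.inv_mult_group F2_cancel
  have "\<forall>s \<in> S. \<forall>x. fst (?\<psi> s) x \<in> S"
    unfolding S_def by (simp add: simps \<delta>_def)
  moreover have "[l] \<in> S" for l
    by (cases l rule: letter_F2_cases) (simp_all add: S_def)
  moreover have "finite S" by (simp add: S_def)
  ultimately have fin: "finite (range (restriction ?\<psi> w))" if "w \<in> carrier F2" for w
    using finite_states [of S w] that by blast
  have \<delta>\<delta>: "fst (?\<psi> ((\<delta> \<cdot> \<delta>) \<up> n)) L1 = \<alpha> \<up> n" "snd (?\<psi> ((\<delta> \<cdot> \<delta>) \<up> n)) x = x"
    "fst (?\<psi> ((\<delta> \<cdot> \<delta>) \<up> n)) L2 = \<beta> \<cdot> (\<alpha> \<up> n \<cdot> \<beta>')" for n x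
    using section_pow_fixed [of "\<delta> \<cdot> \<delta>" L1 n] section_pow_fixed [of "\<delta> \<cdot> \<delta>" L2 n]
      section_pow_fixed [of "\<delta> \<cdot> \<delta>" x n] conj_pow [of \<alpha> \<beta>' n]
    by (simp_all add: \<delta>_def simps)
  let ?R = "recurrent F2 ?\<psi>"
  have even: "\<alpha> \<up> n \<in> ?R" "\<beta> \<cdot> (\<alpha> \<up> n \<cdot> \<beta>') \<in> ?R" for n
    using section_recurrent [of "\<delta> \<up> (2 * n)" F2 ?\<psi>] \<beta>_pow_recurrent(2)
    by (metis odd_even_power(1) reduced_generators(4) \<delta>\<delta>)+
  have odd: "\<beta> \<cdot> \<alpha> \<up> n \<in> ?R" for n
  proof -
    have "fst (?\<psi> (\<delta> \<up> (2 * (- n) + 1))) L1 = inv\<^bsub>F2\<^esub> (\<beta> \<cdot> \<alpha> \<up> n)"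
      unfolding odd_even_power(2) [OF reduced_generators(4)]
      by (simp add: section_mult \<delta>\<delta>) (simp add: \<delta>_def simps F2.int_pow_neg)
    then have "inv\<^bsub>F2\<^esub> (\<beta> \<cdot> \<alpha> \<up> n) \<in> ?R"
      using section_recurrent [OF \<beta>_pow_recurrent(2)] by metis
    then show ?thesis by (simp add: recurrent_inv_iff)
  qed
  have "fst (?\<psi> (\<beta> \<cdot> (\<alpha> \<up> 1 \<cdot> \<beta>'))) L2 = \<beta> \<cdot> (\<beta> \<cdot> \<alpha>)"
    by (simp add: F2.int_pow_1 simps \<delta>_def)
  then have "\<beta> \<cdot> (\<beta> \<cdot> \<alpha>) \<in> ?R"
    using section_recurrent [OF even(2)] by metis
  moreover have "\<epsilon> \<in> ?R"
    using even(1) [of 0] by simp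
  ultimately have "listed_nucleus 6 \<subseteq> ?R"
    unfolding listed_nucleus_def using even odd \<beta>_pow_recurrent
    by (simp add: pm_recurrent UN_subset_iff F2_pow_2 F2.m_assoc)
  then show ?thesis
    using fin by (intro nucleus_claim_lattes) auto
qed


section \<open>The fourteen recursions\<close>

theorem theorem5p1:
  shows "\<forall>i \<in> {1..14}.
     (\<exists>N. is_nucleus F2 (recursion i) N \<and>
          finite (to_quotient F2 (recursion i) ` N) \<and>
          (i \<notin> {2, 5, 6} \<longrightarrow> N \<subseteq> listed_nucleus i) \<and>
          (i \<notin> {2, 9, 11, 14} \<longrightarrow> listed_nucleus i \<subseteq> N)) \<and>
     finite (to_quotient F2 (recursion i) ` listed_nucleus i) \<and>
     sub_hyperbolic F2 (action_biset F2 (recursion i))"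
proof -
  have "nucleus_claim i" if "i \<in> {1..14}" for i
  proof -
    have "i = 1 \<or> i = 2 \<or> i = 3 \<or> i = 4 \<or> i = 5 \<or> i = 6 \<or> i = 7 \<or>
        i = 8 \<or> i = 9 \<or> i = 10 \<or> i = 11 \<or> i = 12 \<or> i = 13 \<or> i = 14"
      using that by (simp add: atLeastAtMost_iff) presburger
    then show ?thesis
      using nucleus_claim_1 nucleus_claim_2 nucleus_claim_3 nucleus_claim_4 nucleus_claim_5
        nucleus_claim_6 nucleus_claim_7 nucleus_claim_8 nucleus_claim_9 nucleus_claim_10
        nucleus_claim_11 nucleus_claim_12 nucleus_claim_13 nucleus_claim_14
      by (elim disjE) (simp_all only:)
  qed
  then show ?thesis
    unfolding nucleus_claim_def by blast
qed

end
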